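(* There exists a computable function $f\in C^\infty(\mathbb{R})$ such that the differentiation operator $D: C^1(\mathbb{R})\to C(\mathbb{R})$, $g\mapsto g'$, is robustly non-computable at $f$; i.e., $f'$ is non-computable and there exists a $C^1$-neighborhood $U$ of $f$ in $C^1(\mathbb{R})$ such that $g'$ is non-computable for every $g\in U$.
   Context: $C(\mathbb{R})$ carries the topology of the metric $d_C(f,g)=\min\{\sup_{x\in\mathbb{R}}|f(x)-g(x)|,1\}$ and $C^1(\mathbb{R})$ the topology of the metric $d_{C^1}(f,g)=\min\{\|f-g\|_1,1\}$ where $\|h\|_1=\sup_{x\in\mathbb{R}}\max\{|h(x)|,|h'(x)|\}$. Computability: a name of $f\in C(\mathbb{R})$ (resp. $C^1(\mathbb{R})$) is a double sequence $(P_{k,l})$ of polynomials with rational coefficients such that $\sup|f-P_{k,l}|<2^{-k}$ (resp. the $C^1$-norm of $f-P_{k,l}$ is $<2^{-k}$) on $[-2^l,2^l]$; $f$ is computable if it has a name computable by a Turing machine. A map $\Phi$ is robustly non-computable at a computable point $x_c$ (with $\Phi(x_c)$ non-computable) if there is an open neighborhood $U$ of $x_c$ such that $\Phi(x)$ is non-computable for all $x\in U$. *)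

theory Defs
  imports
    "HOL-Analysis.Analysis"
    "HOL-Library.Nat_Bijection"
    "HOL-Computational_Algebra.Polynomial"
begin

section \<open>Turing machines\<close>

text \<open>
  Deterministic machines with one two-way infinite tape.  States are the numbers below
  \<open>n_states\<close> (0 is the initial state), tape symbols are the numbers below \<open>n_symbols\<close>
  (0 is the blank, 1 the stroke).  The machine halts when \<open>trans\<close> is undefined.
\<close>

datatype move = Go_Left | Go_Right | Stay

fun shift :: "move \<Rightarrow> int" where
  "shift Go_Left = - 1"
| "shift Go_Right = 1"
| "shift Stay = 0"

record turing_machine =
  n_states :: nat
  n_symbols :: nat
  trans :: "nat \<Rightarrow> nat \<Rightarrow> (nat \<times> nat \<times> move) option"

definition wf_tm :: "turing_machine \<Rightarrow> bool" where
  "wf_tm M \<longleftrightarrow> 1 \<le> n_states M \<and> 2 \<le> n_symbols M \<and>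
     (\<forall>q < n_states M. \<forall>s < n_symbols M. \<forall>q' s' m.
        trans M q s = Some (q', s', m) \<longrightarrow> q' < n_states M \<and> s' < n_symbols M)"

text \<open>A configuration consists of the state, the head position and the tape contents.\<close>

type_synonym tm_config = "nat \<times> int \<times> (int \<Rightarrow> nat)"

fun tm_step :: "turing_machine \<Rightarrow> tm_config \<Rightarrow> tm_config option" where
  "tm_step M (q, h, t) =
     (case trans M q (t h) of
        None \<Rightarrow> None
      | Some (q', s', m) \<Rightarrow> Some (q', h + shift m, t(h := s')))"

definition tm_reaches :: "turing_machine \<Rightarrow> tm_config \<Rightarrow> tm_config \<Rightarrow> bool" where
  "tm_reaches M = (\<lambda>c c'. tm_step M c = Some c')\<^sup>*\<^sup>*"

text \<open>The pair \<open>(k, l)\<close> is written as \<open>k\<close> strokes, a blank, and \<open>l\<close> strokes.\<close>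

definition pair_tape :: "nat \<Rightarrow> nat \<Rightarrow> int \<Rightarrow> nat" where
  "pair_tape k l i = (if 0 \<le> i \<and> i < int k \<or> int k < i \<and> i \<le> int k + int l then 1 else 0)"

text \<open>
  The output is the number of strokes in the word extending from the head position to the
  next blank; what is on the rest of the tape does not matter.
\<close>

definition tm_outputs :: "turing_machine \<Rightarrow> nat \<Rightarrow> nat \<Rightarrow> nat \<Rightarrow> bool" where
  "tm_outputs M k l n \<longleftrightarrow>
     (\<exists>q h t. tm_reaches M (0, 0, pair_tape k l) (q, h, t) \<and> tm_step M (q, h, t) = None \<and>
        (\<forall>i < n. t (h + int i) = 1) \<and> t (h + int n) = 0)"


section \<open>Computable functions on the real line\<close>

text \<open>
  The standard numbering of the rational polynomials: a number is read as a list of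
  coefficients (constant term first), and each coefficient as the fraction \<open>a / (b + 1)\<close>
  for an integer \<open>a\<close> and a natural number \<open>b\<close>.
\<close>

definition rat_decode :: "nat \<Rightarrow> rat" where
  "rat_decode n = (case prod_decode n of (a, b) \<Rightarrow> of_int (int_decode a) / of_nat (Suc b))"

definition rat_poly_decode :: "nat \<Rightarrow> rat poly" where
  "rat_poly_decode n = Poly (map rat_decode (list_decode n))"

lemma surj_rat_decode: "surj rat_decode"
proof -
  have "\<exists>n. rat_decode n = x" for x
  proof (cases x)
    case (Fract a b)
    have "rat_decode (prod_encode (int_encode a, nat b - 1)) = of_int a / of_nat (nat b)"
      using \<open>0 < b\<close> by (simp add: rat_decode_def)
    also have "\<dots> = x"
      using Fract by (simp add: Fract_of_int_quotient)
    finally show ?thesis by blast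
  qed
  then show ?thesis unfolding surj_def by metis
qed

lemma surj_rat_poly_decode: "surj rat_poly_decode"
proof -
  have "\<exists>n. rat_poly_decode n = p" for p
  proof -
    have "rat_poly_decode (list_encode (map (inv rat_decode) (coeffs p))) = p"
      by (simp add: rat_poly_decode_def o_def surj_f_inv_f[OF surj_rat_decode])
    then show ?thesis by blast
  qed
  then show ?thesis unfolding surj_def by metis
qed

definition tm_computable :: "(nat \<Rightarrow> nat \<Rightarrow> rat poly) \<Rightarrow> bool" where
  "tm_computable P \<longleftrightarrow>
     (\<exists>M. wf_tm M \<and> (\<forall>k l. \<exists>n. tm_outputs M k l n \<and> rat_poly_decode n = P k l))"

definition C0_fun :: "(real \<Rightarrow> real) set" where
  "C0_fun = {f. continuous_on UNIV f}"

definition C0_name :: "(real \<Rightarrow> real) \<Rightarrow> (nat \<Rightarrow> nat \<Rightarrow> rat poly) \<Rightarrow> bool" where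
  "C0_name f P \<longleftrightarrow>
     (\<forall>k l. (SUP x\<in>{- (2 ^ l) .. 2 ^ l}. \<bar>f x - poly (map_poly of_rat (P k l)) x\<bar>) < 1 / 2 ^ k)"

definition C0_computable :: "(real \<Rightarrow> real) \<Rightarrow> bool" where
  "C0_computable f \<longleftrightarrow> f \<in> C0_fun \<and> (\<exists>P. C0_name f P \<and> tm_computable P)"


section \<open>The spaces of continuously differentiable and of smooth functions\<close>

definition C1_fun :: "(real \<Rightarrow> real) set" where
  "C1_fun = {f. f differentiable_on UNIV \<and> continuous_on UNIV (deriv f)}"

definition Cinf_fun :: "(real \<Rightarrow> real) set" where
  "Cinf_fun = {f. \<forall>n. (deriv ^^ n) f differentiable_on UNIV}"

text \<open>The norm may be infinite, so it is extended-real valued.\<close>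

definition C1_norm :: "(real \<Rightarrow> real) \<Rightarrow> ereal" where
  "C1_norm h = (SUP x. ereal (max \<bar>h x\<bar> \<bar>deriv h x\<bar>))"

definition C1_dist :: "(real \<Rightarrow> real) \<Rightarrow> (real \<Rightarrow> real) \<Rightarrow> real" where
  "C1_dist f g = real_of_ereal (min (C1_norm (\<lambda>x. f x - g x)) 1)"

lemma C1_norm_nonneg: "0 \<le> C1_norm h"
  unfolding C1_norm_def by (rule SUP_upper2[of 0]) (auto simp: le_max_iff_disj)

lemma ereal_C1_dist: "ereal (C1_dist f g) = min (C1_norm (\<lambda>x. f x - g x)) 1"
  using C1_norm_nonneg[of "\<lambda>x. f x - g x"]
  by (cases "C1_norm (\<lambda>x. f x - g x)") (auto simp: C1_dist_def min_def one_ereal_def)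

lemma abs_deriv_minus: "\<bar>deriv (\<lambda>x. - h x) x\<bar> = \<bar>deriv h (x::real)\<bar>"
proof (cases "h field_differentiable at x")
  case True
  then show ?thesis by simp
next
  case False
  then have "\<not> (\<lambda>x. - h x) field_differentiable at x"
    using field_differentiable_minus[of "\<lambda>x. - h x" "at x"] by auto
  with False show ?thesis
    by (simp add: deriv_def field_differentiable_def)
qed

lemma Metric_space_C1: "Metric_space C1_fun C1_dist"
proof
  show "0 \<le> C1_dist f g" for f g
    unfolding C1_dist_def using C1_norm_nonneg by (simp add: real_of_ereal_pos)
  show "C1_dist f g = C1_dist g f" for f g
  proof -
    have "\<bar>deriv (\<lambda>x. f x - g x) x\<bar> = \<bar>deriv (\<lambda>x. g x - f x) x\<bar>" for x
      using abs_deriv_minus[of "\<lambda>x. g x - f x" x] by simp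
    then show ?thesis
      by (simp add: C1_dist_def C1_norm_def abs_minus_commute)
  qed
  have D: "h field_differentiable at x" if "h \<in> C1_fun" for h x
    using that by (auto simp: C1_fun_def differentiable_on_def
        field_differentiable_def real_differentiable_def)
  show "C1_dist f g = 0 \<longleftrightarrow> f = g" for f g
  proof
    assume "C1_dist f g = 0"
    then have "min (C1_norm (\<lambda>x. f x - g x)) 1 = 0"
      using ereal_C1_dist[of f g] by (simp add: zero_ereal_def)
    then have z: "C1_norm (\<lambda>x. f x - g x) = 0"
      by (auto simp: min_def split: if_splits)
    have "f x = g x" for x
    proof -
      have "ereal \<bar>f x - g x\<bar> \<le> ereal (max \<bar>f x - g x\<bar> \<bar>deriv (\<lambda>x. f x - g x) x\<bar>)"
        by simp
      also have "\<dots> \<le> C1_norm (\<lambda>x. f x - g x)"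
        unfolding C1_norm_def by (rule SUP_upper) simp
      also have "\<dots> = ereal 0"
        using z by (simp add: zero_ereal_def)
      finally show ?thesis by simp
    qed
    then show "f = g" by blast
  next
    assume "f = g"
    then show "C1_dist f g = 0"
      by (simp add: C1_dist_def C1_norm_def)
  qed
  show "C1_dist f h \<le> C1_dist f g + C1_dist g h"
    if "f \<in> C1_fun" "g \<in> C1_fun" "h \<in> C1_fun" for f g h
  proof -
    let ?a = "C1_norm (\<lambda>x. f x - g x)" and ?b = "C1_norm (\<lambda>x. g x - h x)"
    have "C1_norm (\<lambda>x. f x - h x) \<le> ?a + ?b"
      unfolding C1_norm_def[of "\<lambda>x. f x - h x"]
    proof (rule SUP_least)
      fix x
      have "ereal (max \<bar>f x - g x\<bar> \<bar>deriv (\<lambda>x. f x - g x) x\<bar>) \<le> ?a"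
        and "ereal (max \<bar>g x - h x\<bar> \<bar>deriv (\<lambda>x. g x - h x) x\<bar>) \<le> ?b"
        unfolding C1_norm_def by (rule SUP_upper, simp)+
      then have "ereal (max \<bar>f x - g x\<bar> \<bar>deriv (\<lambda>x. f x - g x) x\<bar>) +
          ereal (max \<bar>g x - h x\<bar> \<bar>deriv (\<lambda>x. g x - h x) x\<bar>) \<le> ?a + ?b"
        by (rule add_mono)
      moreover have "max \<bar>f x - h x\<bar> \<bar>deriv (\<lambda>x. f x - h x) x\<bar> \<le>
          max \<bar>f x - g x\<bar> \<bar>deriv (\<lambda>x. f x - g x) x\<bar> +
          max \<bar>g x - h x\<bar> \<bar>deriv (\<lambda>x. g x - h x) x\<bar>"
        using D[OF that(1), of x] D[OF that(2), of x] D[OF that(3), of x]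
        by (simp only: deriv_diff)
      ultimately show "ereal (max \<bar>f x - h x\<bar> \<bar>deriv (\<lambda>x. f x - h x) x\<bar>) \<le> ?a + ?b"
        unfolding plus_ereal.simps by (meson ereal_less_eq(3) order_trans)
    qed
    moreover have "0 \<le> ?a" "0 \<le> ?b" by (auto intro: C1_norm_nonneg)
    ultimately have "min (C1_norm (\<lambda>x. f x - h x)) 1 \<le> min ?a 1 + min ?b 1"
      by (cases "C1_norm (\<lambda>x. f x - h x)"; cases ?a; cases ?b)
        (auto simp: min_def one_ereal_def)
    then show ?thesis
      unfolding ereal_C1_dist[symmetric] by simp
  qed
qed

abbreviation C1_topology :: "(real \<Rightarrow> real) topology" where
  "C1_topology \<equiv> Metric_space.mtopology C1_fun C1_dist"


section \<open>Robust non-computability\<close>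

text \<open>
  \<open>X\<close> is the topology of the domain; \<open>A\<close> and \<open>B\<close> say which arguments and which values are
  computable.  For differentiation on \<open>C\<^sup>1\<close>, an argument is computable if it is so as an
  element of \<open>C\<close>: differentiating the polynomials of a computable \<open>C\<^sup>1\<close>-name of \<open>f\<close> yields
  a computable name of the derivative.
\<close>

definition robustly_noncomputable_at ::
    "'a topology \<Rightarrow> ('a \<Rightarrow> bool) \<Rightarrow> ('b \<Rightarrow> bool) \<Rightarrow> ('a \<Rightarrow> 'b) \<Rightarrow> 'a \<Rightarrow> bool" where
  "robustly_noncomputable_at X A B \<Phi> x \<longleftrightarrow>
     x \<in> topspace X \<and> A x \<and> \<not> B (\<Phi> x) \<and>
     (\<exists>U. openin X U \<and> x \<in> U \<and> (\<forall>y\<in>U. \<not> B (\<Phi> y)))"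

end

theory Submission
  imports Defs "HOL-Complex_Analysis.Complex_Analysis"
begin

text \<open>
  If the Turing machine with code \<open>e\<close>, run on the input \<open>(0, e)\<close>, halts after exactly \<open>s\<close> steps, then
  \<open>f\<close> gets the summand \<open>u (x - e) exp (- u\<^sup>4 (x - e)\<^sup>2)\<close> with \<open>u = w\<^bsup>2w\<^esup>\<close> and \<open>w = e + s + 2\<close>; a machine
  that does not halt contributes nothing.  The summand is at most \<open>1 / u\<close> everywhere.  Hence running the
  first \<open>j\<close> machines for \<open>j\<close> steps determines \<open>f\<close> up to an error well below \<open>1 / 2\<^sup>j\<close>, and Taylor
  polynomials of the exponential function turn this into a name of \<open>f\<close>.  The series converges locally
  uniformly on the complex plane, so \<open>f\<close> is the restriction of an entire function.

  The derivative of the summand at \<open>e\<close> is \<open>u\<close>, and the other summands change it by at most \<open>1 / 2\<close>.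
  Within \<open>s\<close> steps the machine can only output a number \<open>n \<le> e + s\<close>, and \<open>u\<close> exceeds the absolute value
  at \<open>e\<close> of every polynomial with such a code by at least 3.  So no machine computes a name of a function
  that is within \<open>1 / 2\<close> of the derivative of \<open>f\<close>: the machine's own polynomial for precision \<open>0\<close> on
  \<open>[- 2\<^sup>e, 2\<^sup>e]\<close> is wrong at the point \<open>e\<close>.
\<close>

section \<open>Compiling while programs to Turing machines\<close>

text \<open>While programs are the intermediate language: every primitive recursive function becomes
  such a program, and every such program a Turing machine.\<close>

datatype prog = Inc nat | Dec nat | Seq prog prog | IfNZ nat prog prog | WhileNZ nat prog

inductive exec :: "prog \<Rightarrow> (nat \<Rightarrow> nat) \<Rightarrow> (nat \<Rightarrow> nat) \<Rightarrow> bool" where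
  Inc: "exec (Inc r) \<sigma> (\<sigma>(r := Suc (\<sigma> r)))"
| Dec: "exec (Dec r) \<sigma> (\<sigma>(r := \<sigma> r - 1))"
| Seq: "exec c \<sigma> \<sigma>' \<Longrightarrow> exec d \<sigma>' \<sigma>'' \<Longrightarrow> exec (Seq c d) \<sigma> \<sigma>''"
| If_nz: "\<sigma> r \<noteq> 0 \<Longrightarrow> exec c \<sigma> \<sigma>' \<Longrightarrow> exec (IfNZ r c d) \<sigma> \<sigma>'"
| If_z: "\<sigma> r = 0 \<Longrightarrow> exec d \<sigma> \<sigma>' \<Longrightarrow> exec (IfNZ r c d) \<sigma> \<sigma>'"
| While_nz: "\<sigma> r \<noteq> 0 \<Longrightarrow> exec c \<sigma> \<sigma>' \<Longrightarrow> exec (WhileNZ r c) \<sigma>' \<sigma>'' \<Longrightarrow>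
    exec (WhileNZ r c) \<sigma> \<sigma>''"
| While_z: "\<sigma> r = 0 \<Longrightarrow> exec (WhileNZ r c) \<sigma> \<sigma>"

fun code_len :: "prog \<Rightarrow> nat" where
  "code_len (Inc r) = 2"
| "code_len (Dec r) = 3"
| "code_len (Seq c d) = code_len c + code_len d"
| "code_len (IfNZ r c d) = code_len c + code_len d + 2"
| "code_len (WhileNZ r c) = code_len c + 2"

fun num_regs :: "prog \<Rightarrow> nat" where
  "num_regs (Inc r) = Suc r"
| "num_regs (Dec r) = Suc r"
| "num_regs (Seq c d) = max (num_regs c) (num_regs d)"
| "num_regs (IfNZ r c d) = max (Suc r) (max (num_regs c) (num_regs d))"
| "num_regs (WhileNZ r c) = max (Suc r) (num_regs c)"

text \<open>
  With \<open>m\<close> registers, bit \<open>r\<close> of the symbol in cell \<open>i \<ge> 0\<close> tells whether \<open>i < \<sigma> r\<close>: every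
  register has its own track, on which it is written in unary.  Cell \<open>-1\<close> carries the symbol
  \<open>2 ^ m\<close>, which marks the left end.
\<close>

definition tape_of :: "nat \<Rightarrow> (nat \<Rightarrow> nat) \<Rightarrow> (int \<Rightarrow> nat) \<Rightarrow> bool" where
  "tape_of m \<sigma> t \<longleftrightarrow> t (- 1) = 2 ^ m \<and> (\<forall>i r. bit (t (int i)) r \<longleftrightarrow> r < m \<and> i < \<sigma> r)"

definition rewind :: "nat \<Rightarrow> nat \<Rightarrow> nat \<Rightarrow> nat \<Rightarrow> (nat \<times> nat \<times> move) option" where
  "rewind m q q' s = (if s = 2 ^ m then Some (q', s, Go_Right) else Some (q, s, Go_Left))"

text \<open>A program occupies the states from \<open>a\<close> to
  \<open>a + code_len c - 1\<close>. It is entered at \<open>a\<close> and left for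
  \<open>a + code_len c\<close>, both times with the head on cell 0. In \<open>Dec\<close>, state
  \<open>a + 1\<close> is on the marker if the register is 0, and otherwise on the last cell of the
  word, which is erased.\<close>

fun code :: "nat \<Rightarrow> prog \<Rightarrow> nat \<Rightarrow> nat \<Rightarrow> nat \<Rightarrow> (nat \<times> nat \<times> move) option" where
  "code m (Inc r) a q s =
     (if q = a then (if bit s r then Some (a, s, Go_Right) else Some (a + 1, set_bit r s, Go_Left))
      else rewind m (a + 1) (a + 2) s)"
| "code m (Dec r) a q s =
     (if q = a then (if bit s r then Some (a, s, Go_Right) else Some (a + 1, s, Go_Left))
      else if q = a + 1 then
        (if s = 2 ^ m then Some (a + 3, s, Go_Right) else Some (a + 2, unset_bit r s, Go_Left))
      else rewind m (a + 2) (a + 3) s)"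
| "code m (Seq c d) a q s =
     (if q < a + code_len c then code m c a q s else code m d (a + code_len c) q s)"
| "code m (IfNZ r c d) a q s =
     (if q = a then Some (if bit s r then a + 1 else a + 2 + code_len c, s, Stay)
      else if q < a + 1 + code_len c then code m c (a + 1) q s
      else if q = a + 1 + code_len c then Some (a + 2 + code_len c + code_len d, s, Stay)
      else code m d (a + 2 + code_len c) q s)"
| "code m (WhileNZ r c) a q s =
     (if q = a then Some (if bit s r then a + 1 else a + 2 + code_len c, s, Stay)
      else if q < a + 1 + code_len c then code m c (a + 1) q s
      else Some (a, s, Stay))"

lemma tm_reaches_refl: "tm_reaches M c c"
  by (simp add: tm_reaches_def)

lemma tm_reaches_trans: "tm_reaches M c c' \<Longrightarrow> tm_reaches M c' c'' \<Longrightarrow> tm_reaches M c c''"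
  by (simp add: tm_reaches_def)

lemma tm_reaches_step: "tm_step M c = Some c' \<Longrightarrow> tm_reaches M c' c'' \<Longrightarrow> tm_reaches M c c''"
  by (simp add: tm_reaches_def converse_rtranclp_into_rtranclp)

text \<open>The start \<open>int n - 1\<close> allows \<open>n = 0\<close>, where the head is
  already on the marker.\<close>

lemma reaches_rewind:
  assumes tr: "\<And>s. trans M q s = rewind m q q' s"
    and "t (- 1) = 2 ^ m" and "\<And>i. i < n \<Longrightarrow> t (int i) \<noteq> 2 ^ m"
  shows "tm_reaches M (q, int n - 1, t) (q', 0, t)"
  using assms(3)
proof (induction n)
  case 0
  show ?case
    by (rule tm_reaches_step[OF _ tm_reaches_refl]) (simp add: tr rewind_def assms(2) fun_upd_idem)
next
  case (Suc n)
  then have "t (int n) \<noteq> 2 ^ m" and *: "tm_reaches M (q, int n - 1, t) (q', 0, t)"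
    by auto
  then show ?case
    by (intro tm_reaches_step[OF _ *]) (simp add: tr rewind_def)
qed

lemma reaches_scan:
  assumes tr: "\<And>i. i < n \<Longrightarrow> trans M q (t (int i)) = Some (q, t (int i), Go_Right)"
  shows "tm_reaches M (q, 0, t) (q, int n, t)"
  using tr
proof (induction n)
  case 0
  show ?case by (simp add: tm_reaches_refl)
next
  case (Suc n)
  then have "trans M q (t (int n)) = Some (q, t (int n), Go_Right)"
    and *: "tm_reaches M (q, 0, t) (q, int n, t)"
    by auto
  then show ?case
    by (intro tm_reaches_trans[OF *] tm_reaches_step[OF _ tm_reaches_refl]) (simp add: add.commute)
qed

text \<open>Formulated for a single track instead of \<open>tape_of\<close>, so that it also applies
  to the input tape, where the gap between the two words is filled.\<close>

lemma reaches_Inc: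
  assumes tr: "\<And>q s. a \<le> q \<Longrightarrow> q < a + 2 \<Longrightarrow> trans M q s = code m (Inc r) a q s"
    and "t (- 1) = 2 ^ m" and "\<And>i. i < n \<Longrightarrow> t (int i) \<noteq> 2 ^ m"
    and "\<And>i. i < n \<Longrightarrow> bit (t (int i)) r" and "\<not> bit (t (int n)) r"
  shows "tm_reaches M (a, 0, t) (a + 2, 0, t(int n := set_bit r (t (int n))))"
    (is "tm_reaches M _ (_, _, ?t)")
proof (rule tm_reaches_trans[OF reaches_scan[where n = n]])
  show "tm_reaches M (a, int n, t) (a + 2, 0, ?t)"
  proof (rule tm_reaches_step)
    show "tm_step M (a, int n, t) = Some (a + 1, int n - 1, ?t)"
      using assms(5) by (simp add: tr)
    show "tm_reaches M (a + 1, int n - 1, ?t) (a + 2, 0, ?t)"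
      by (rule reaches_rewind[where m = m]) (use assms(2,3) in \<open>auto simp: tr\<close>)
  qed
qed (simp add: tr assms(4))

lemma tape_of_cell_0: "tape_of m \<sigma> t \<Longrightarrow> bit (t 0) r \<longleftrightarrow> r < m \<and> 0 < \<sigma> r"
  unfolding tape_of_def by (metis of_nat_0)

lemma tape_of_ne:
  assumes "tape_of m \<sigma> t"
  shows "t (int i) \<noteq> 2 ^ m"
proof
  assume "t (int i) = 2 ^ m"
  then have "bit (t (int i)) m" by (simp add: bit_exp_iff)
  then show False using assms by (simp add: tape_of_def)
qed

text \<open>Rule induction on the execution. Every program brings the head back to cell 0, so that
  the blocks of states can be chained.\<close>

lemma reaches_code:
  assumes "exec c \<sigma> \<sigma>'" and "num_regs c \<le> m"
    and "\<And>q s. a \<le> q \<Longrightarrow> q < a + code_len c \<Longrightarrow> trans M q s = code m c a q s"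
    and "tape_of m \<sigma> t"
  shows "\<exists>t'. tape_of m \<sigma>' t' \<and> tm_reaches M (a, 0, t) (a + code_len c, 0, t')"
  using assms
proof (induction arbitrary: a t)
  case (Inc r \<sigma>)
  then have r: "r < m" by simp
  let ?t = "t(int (\<sigma> r) := set_bit r (t (int (\<sigma> r))))"
  have "tm_reaches M (a, 0, t) (a + 2, 0, ?t)"
    by (rule reaches_Inc[where m = m])
      (use Inc r tape_of_ne[OF Inc(3)] in \<open>auto simp: tape_of_def\<close>)
  moreover have "tape_of m (\<sigma>(r := Suc (\<sigma> r))) ?t"
    using Inc(3) r by (auto simp: tape_of_def bit_set_bit_iff less_Suc_eq)
  ultimately show ?case by (auto simp del: fun_upd_apply)
next
  case (Dec r \<sigma>)
  then have r: "r < m" by simp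
  have tr: "trans M q s = code m (Dec r) a q s" if "a \<le> q" "q < a + 3" for q s
    using Dec that by simp
  have scan: "tm_reaches M (a, 0, t) (a, int (\<sigma> r), t)"
    by (rule reaches_scan) (use Dec(3) r in \<open>simp add: tr tape_of_def\<close>)
  have turn: "tm_step M (a, int (\<sigma> r), t) = Some (a + 1, int (\<sigma> r) - 1, t)"
    using Dec(3) r by (simp add: tr tape_of_def)
  show ?case
  proof (cases "\<sigma> r")
    case 0
    \<comment> \<open>The scan stops at cell 0, and the step left leads onto the marker. Nothing is
      erased, in accordance with \<open>0 - 1 = 0\<close>.\<close>
    have "tm_step M (a + 1, - 1, t) = Some (a + 3, 0, t)"
      using Dec(3) by (simp add: tr tape_of_def fun_upd_idem)
    then have "tm_reaches M (a, 0, t) (a + 3, 0, t)"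
      using 0 by (intro tm_reaches_trans[OF scan] tm_reaches_step[OF turn]
          tm_reaches_step[OF _ tm_reaches_refl]) simp
    then show ?thesis
      using 0 Dec(3) by (auto simp: fun_upd_idem)
  next
    case (Suc n)
    let ?t = "t(int n := unset_bit r (t (int n)))"
    have "tm_step M (a + 1, int n, t) = Some (a + 2, int n - 1, ?t)"
      using tape_of_ne[OF Dec(3)] by (simp add: tr)
    moreover have "tm_reaches M (a + 2, int n - 1, ?t) (a + 3, 0, ?t)"
      by (rule reaches_rewind[where m = m])
        (use Dec(3) tape_of_ne[OF Dec(3)] in \<open>auto simp: tr tape_of_def\<close>)
    ultimately have "tm_reaches M (a, 0, t) (a + 3, 0, ?t)"
      using Suc by (intro tm_reaches_trans[OF scan] tm_reaches_step[OF turn])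
        (simp add: tm_reaches_step)
    moreover have "tape_of m (\<sigma>(r := n)) ?t"
      using Dec(3) Suc by (auto simp: tape_of_def bit_unset_bit_iff less_Suc_eq)
    ultimately show ?thesis
      using Suc by (auto simp del: fun_upd_apply)
  qed
next
  case (Seq c \<sigma> \<sigma>' d \<sigma>'')
  have "\<exists>t'. tape_of m \<sigma>' t' \<and> tm_reaches M (a, 0, t) (a + code_len c, 0, t')"
    using Seq.prems by (intro Seq.IH(1)) auto
  then obtain t' where t': "tape_of m \<sigma>' t'" "tm_reaches M (a, 0, t) (a + code_len c, 0, t')"
    by blast
  have "\<exists>t''. tape_of m \<sigma>'' t'' \<and>
      tm_reaches M (a + code_len c, 0, t') (a + code_len c + code_len d, 0, t'')"
    using Seq.prems t' by (intro Seq.IH(2)) auto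
  then show ?case
    using t'(2) by (auto simp: add.assoc intro: tm_reaches_trans)
next
  case (If_nz \<sigma> r c \<sigma>' d)
  have 1: "tm_step M (a, 0, t) = Some (a + 1, 0, t)"
    using If_nz.prems If_nz.hyps by (auto simp: tape_of_cell_0)
  have "\<exists>t'. tape_of m \<sigma>' t' \<and> tm_reaches M (a + 1, 0, t) (a + 1 + code_len c, 0, t')"
    using If_nz.prems by (intro If_nz.IH) auto
  then obtain t' where t': "tape_of m \<sigma>' t'"
    "tm_reaches M (a + 1, 0, t) (a + 1 + code_len c, 0, t')"
    by blast
  have 2: "tm_step M (a + 1 + code_len c, 0, t') = Some (a + 2 + code_len c + code_len d, 0, t')"
    using If_nz.prems by simp
  show ?case
    using tm_reaches_step[OF 1 tm_reaches_trans[OF t'(2) tm_reaches_step[OF 2 tm_reaches_refl]]] t'(1)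
    by (auto simp: add_ac)
next
  case (If_z \<sigma> r d \<sigma>' c)
  have 1: "tm_step M (a, 0, t) = Some (a + 2 + code_len c, 0, t)"
    using If_z.prems If_z.hyps by (auto simp: tape_of_cell_0)
  have "\<exists>t'. tape_of m \<sigma>' t' \<and>
      tm_reaches M (a + 2 + code_len c, 0, t) (a + 2 + code_len c + code_len d, 0, t')"
    using If_z.prems by (intro If_z.IH) auto
  then show ?case
    using tm_reaches_step[OF 1] by (auto simp: add_ac)
next
  case (While_nz \<sigma> r c \<sigma>' \<sigma>'')
  have 1: "tm_step M (a, 0, t) = Some (a + 1, 0, t)"
    using While_nz.prems While_nz.hyps by (auto simp: tape_of_cell_0)
  have "\<exists>t'. tape_of m \<sigma>' t' \<and> tm_reaches M (a + 1, 0, t) (a + 1 + code_len c, 0, t')"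
    using While_nz.prems by (intro While_nz.IH(1)) auto
  then obtain t' where t': "tape_of m \<sigma>' t'"
    "tm_reaches M (a + 1, 0, t) (a + 1 + code_len c, 0, t')"
    by blast
  have 2: "tm_step M (a + 1 + code_len c, 0, t') = Some (a, 0, t')"
    using While_nz.prems by simp
  have "tm_reaches M (a, 0, t) (a, 0, t')"
    using tm_reaches_step[OF 1 tm_reaches_trans[OF t'(2) tm_reaches_step[OF 2 tm_reaches_refl]]] .
  moreover have "\<exists>t''. tape_of m \<sigma>'' t'' \<and>
      tm_reaches M (a, 0, t') (a + code_len (WhileNZ r c), 0, t'')"
    using While_nz.prems t' by (intro While_nz.IH(2)) auto
  ultimately show ?case
    by (blast intro: tm_reaches_trans)
next
  case (While_z \<sigma> r c)
  have 1: "tm_step M (a, 0, t) = Some (a + 2 + code_len c, 0, t)"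
    using While_z.prems While_z.hyps by (auto simp: tape_of_cell_0)
  show ?case
    using tm_reaches_step[OF 1 tm_reaches_refl] While_z.prems by (auto simp: add_ac)
qed

lemma set_bit_less: "r < m \<Longrightarrow> s < 2 ^ m \<Longrightarrow> set_bit r s < (2::nat) ^ m"
  by (metis not_le take_bit_nat_eq_self take_bit_nat_eq_self_iff take_bit_set_bit_eq)

lemma unset_bit_less: "s < 2 ^ m \<Longrightarrow> unset_bit r s < (2::nat) ^ m"
  by (metis take_bit_nat_eq_self take_bit_nat_less_exp take_bit_unset_bit_eq bit_eq_iff
      bit_unset_bit_iff bit_take_bit_iff take_bit_nat_eq_self_iff)

text \<open>These bounds make the final machine well formed. The next state may be the exit
  \<open>a + code_len c\<close>, and \<open>2 ^ Suc m\<close> leaves room for the marker.\<close>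

lemma code_bounds:
  assumes "code m c a q s = Some (q', s', d)" "num_regs c \<le> m" "s < 2 ^ Suc m"
    "a \<le> q" "q < a + code_len c"
  shows "q' \<le> a + code_len c \<and> s' < 2 ^ Suc m"
  using assms
proof (induction c arbitrary: a)
  case (Inc r)
  then show ?case
    using set_bit_less[of r "Suc m" s] by (auto simp: rewind_def split: if_splits)
next
  case (Dec r)
  then show ?case
    using unset_bit_less[of s "Suc m" r] by (auto simp: rewind_def simp del: power_Suc split: if_splits)
next
  case (Seq c d)
  then show ?case
    by (fastforce simp del: power_Suc split: if_splits)
next
  case (IfNZ r c d)
  then show ?case
    by (fastforce simp del: power_Suc split: if_splits)
next
  case (WhileNZ r c)
  then show ?case
    by (fastforce simp del: power_Suc split: if_splits)
qed

text \<open>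
  The machine marks cell \<open>-1\<close>.  Then \<open>Inc 0\<close> fills the blank that separates the two inputs
  \<open>k\<close> and \<open>l\<close>, so that register 0 holds \<open>k + l + 1\<close>.
\<close>

definition prog_tm :: "nat \<Rightarrow> prog \<Rightarrow> turing_machine" where
  "prog_tm m c = \<lparr>n_states = code_len c + 5, n_symbols = 2 ^ Suc m,
     trans = (\<lambda>q s.
       if q = 0 then Some (1, s, Go_Left)
       else if q = 1 then Some (2, 2 ^ m, Go_Right)
       else if q < 2 + code_len c then code m c 2 q s
       else if q = 2 + code_len c then
         (if bit s 0 then Some (2 + code_len c, 1, Go_Right) else Some (3 + code_len c, 0, Go_Left))
       else if q = 3 + code_len c then rewind m (3 + code_len c) (4 + code_len c) s
       else None)\<rparr>"

lemma wf_prog_tm: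
  assumes "num_regs c \<le> m" "0 < m"
  shows "wf_tm (prog_tm m c)"
proof -
  have [simp]: "2 ^ m < (2 :: nat) ^ Suc m" "2 \<le> (2 :: nat) ^ Suc m" "Suc 0 < (2 :: nat) ^ Suc m"
    using one_less_power[of "2::nat" "Suc m"] by (auto simp del: one_less_power)
  have "q' < code_len c + 5 \<and> s' < 2 ^ Suc m"
    if "code m c 2 q s = Some (q', s', d)" "s < 2 ^ Suc m" "\<not> q \<le> 1" "q < 2 + code_len c"
    for q s q' s' d
    using code_bounds[OF that(1) assms(1) that(2)] that by auto
  then show ?thesis
    by (auto simp: wf_tm_def prog_tm_def rewind_def simp del: power_Suc split: if_splits)
qed

text \<open>An output word consists of symbols 1, so the other tracks have to be erased: after the
  program, a sweep to the right replaces each cell of the word in register 0 by 1 and the cell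
  behind it by the blank; then the head returns to cell 0.\<close>

lemma prog_tm_outputs:
  assumes ex: "exec c ((\<lambda>_. 0)(0 := k + l + 1)) \<sigma>"
    and m: "num_regs (Seq (Inc 0) c) \<le> m"
  shows "tm_outputs (prog_tm m (Seq (Inc 0) c)) k l (\<sigma> 0)"
proof -
  let ?c = "Seq (Inc 0) c"
  let ?M = "prog_tm m ?c" and ?b = "code_len c + 4"
  let ?t0 = "(pair_tape k l)(- 1 := 2 ^ m)"
  let ?t1 = "?t0(int k := set_bit 0 (?t0 (int k)))"
  have m0: "0 < m" "num_regs c \<le> m" using m by auto
  then have ne: "2 ^ m \<noteq> (1::nat)" "2 ^ m \<noteq> Suc 0" "Suc 0 \<noteq> 2 ^ m" by (auto dest: sym)
  have start: "tm_reaches ?M (0, 0, pair_tape k l) (2, 0, ?t0)"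
    by (intro tm_reaches_step[OF _ tm_reaches_step[OF _ tm_reaches_refl]])
      (auto simp: prog_tm_def fun_upd_idem)
  have fill: "tm_reaches ?M (2, 0, ?t0) (2 + 2, 0, ?t1)"
    by (rule reaches_Inc[where m = m])
      (use m0 ne in \<open>auto simp: prog_tm_def pair_tape_def bit_0\<close>)
  \<comment> \<open>The stroke 1 has only bit 0, so all registers other than 0 start empty.\<close>
  have tape: "tape_of m ((\<lambda>_. 0)(0 := k + l + 1)) ?t1"
    using m0 by (auto simp: tape_of_def pair_tape_def bit_Suc_0_iff bit_set_bit_iff)
  have "\<exists>t. tape_of m \<sigma> t \<and> tm_reaches ?M (4, 0, ?t1) (4 + code_len c, 0, t)"
    by (rule reaches_code[OF ex m0(2) _ tape]) (simp add: prog_tm_def)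
  then obtain t where t: "tape_of m \<sigma> t" "tm_reaches ?M (4, 0, ?t1) (?b, 0, t)"
    by (auto simp: add.commute)
  define u where "u n i = (if 0 \<le> i \<and> i < int n then 1 else t i)" for n i
  have sweep: "tm_reaches ?M (?b, 0, t) (?b, int n, u n)" if "n \<le> \<sigma> 0" for n
    using that
  proof (induction n)
    case 0
    have "u 0 = t" by (auto simp: u_def)
    then show ?case by (simp add: tm_reaches_refl)
  next
    case (Suc n)
    have "bit (u n (int n)) 0"
      using Suc.prems t(1) m0 by (simp add: u_def tape_of_def)
    moreover have "(u n)(int n := 1) = u (Suc n)"
      by (auto simp: u_def)
    ultimately have "tm_step ?M (?b, int n, u n) = Some (?b, int (Suc n), u (Suc n))"
      by (simp add: prog_tm_def)
    with Suc show ?case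
      by (meson Suc_leD tm_reaches_trans tm_reaches_step tm_reaches_refl)
  qed
  define v where "v = (u (\<sigma> 0))(int (\<sigma> 0) := 0)"
  have "\<not> bit (u (\<sigma> 0) (int (\<sigma> 0))) 0"
    using t(1) by (simp add: u_def tape_of_def)
  then have turn: "tm_step ?M (?b, int (\<sigma> 0), u (\<sigma> 0)) = Some (?b + 1, int (\<sigma> 0) - 1, v)"
    by (simp add: prog_tm_def v_def)
  have home: "tm_reaches ?M (?b + 1, int (\<sigma> 0) - 1, v) (?b + 2, 0, v)"
    by (intro reaches_rewind[where m = m])
      (use t(1) ne in \<open>auto simp: prog_tm_def v_def u_def tape_of_def\<close>)
  have "tm_reaches ?M (0, 0, pair_tape k l) (?b + 2, 0, v)"
    using tm_reaches_trans[OF start fill] t(2) sweep[OF order_refl] tm_reaches_step[OF turn home]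
    by (auto intro: tm_reaches_trans)
  moreover have "tm_step ?M (?b + 2, 0, v) = None"
    by (simp add: prog_tm_def)
  ultimately show ?thesis
    unfolding tm_outputs_def
    by (intro exI[of _ "?b + 2"] exI[of _ 0] exI[of _ v]) (auto simp: v_def u_def)
qed

section \<open>Primitive recursive functions\<close>

text \<open>\<open>S i\<close> is the state with \<open>i\<close> passes still to go; the counter
  register itself indexes the states.\<close>

lemma exec_WhileNZ_family:
  assumes "\<And>i. i \<le> n \<Longrightarrow> S i r = i" "\<And>i. i < n \<Longrightarrow> exec c (S (Suc i)) (S i)"
  shows "exec (WhileNZ r c) (S n) (S 0)"
  using assms
proof (induction n)
  case 0
  then show ?case by (simp add: exec.While_z)
next
  case (Suc n)
  then show ?case
    by (intro exec.While_nz[of "S (Suc n)" r c "S n"]) auto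
qed

lemma exec_eq: "exec c \<sigma> \<tau> \<Longrightarrow> \<tau> = \<tau>' \<Longrightarrow> exec c \<sigma> \<tau>'"
  by simp

definition clear :: "nat \<Rightarrow> prog" where
  "clear r = WhileNZ r (Dec r)"

lemma exec_clear: "exec (clear r) \<sigma> (\<sigma>(r := 0))"
proof -
  have "exec (WhileNZ r (Dec r)) (\<sigma>(r := \<sigma> r)) (\<sigma>(r := 0))"
  proof (rule exec_WhileNZ_family)
    show "exec (Dec r) (\<sigma>(r := Suc i)) (\<sigma>(r := i))" for i
      using exec.Dec[of r "\<sigma>(r := Suc i)"] by simp
  qed simp
  then show ?thesis by (simp add: clear_def)
qed

definition move_reg :: "nat \<Rightarrow> nat \<Rightarrow> prog" where
  "move_reg a d = WhileNZ a (Seq (Dec a) (Inc d))"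

lemma exec_move_reg:
  assumes "a \<noteq> d"
  shows "exec (move_reg a d) \<sigma> (\<sigma>(a := 0, d := \<sigma> d + \<sigma> a))"
proof -
  define S where "S i = \<sigma>(a := i, d := \<sigma> d + (\<sigma> a - i))" for i
  have "exec (move_reg a d) (S (\<sigma> a)) (S 0)"
    unfolding move_reg_def
  proof (rule exec_WhileNZ_family)
    fix i assume "i < \<sigma> a"
    then show "exec (Seq (Dec a) (Inc d)) (S (Suc i)) (S i)"
      using assms by (intro exec_eq[OF exec.Seq[OF exec.Dec exec.Inc]]) (auto simp: S_def fun_eq_iff)
  qed (use assms in \<open>simp add: S_def\<close>)
  moreover have "S (\<sigma> a) = \<sigma>" by (auto simp: S_def)
  ultimately show ?thesis by (simp add: S_def)
qed

definition copy_reg :: "nat \<Rightarrow> nat \<Rightarrow> nat \<Rightarrow> prog" where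
  "copy_reg a d t = Seq (WhileNZ a (Seq (Dec a) (Seq (Inc d) (Inc t)))) (move_reg t a)"

lemma exec_copy_reg:
  assumes "a \<noteq> d" "a \<noteq> t" "d \<noteq> t" "\<sigma> t = 0"
  shows "exec (copy_reg a d t) \<sigma> (\<sigma>(d := \<sigma> d + \<sigma> a))"
proof -
  define S where "S i = \<sigma>(a := i, d := \<sigma> d + (\<sigma> a - i), t := \<sigma> a - i)" for i
  have "exec (WhileNZ a (Seq (Dec a) (Seq (Inc d) (Inc t)))) (S (\<sigma> a)) (S 0)"
  proof (rule exec_WhileNZ_family)
    fix i assume "i < \<sigma> a"
    then show "exec (Seq (Dec a) (Seq (Inc d) (Inc t))) (S (Suc i)) (S i)"
      using assms
      by (intro exec_eq[OF exec.Seq[OF exec.Dec exec.Seq[OF exec.Inc exec.Inc]]]) (auto simp: S_def fun_eq_iff)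
  qed (use assms in \<open>simp add: S_def\<close>)
  moreover have "S (\<sigma> a) = \<sigma>" using assms by (auto simp: S_def)
  ultimately show ?thesis
    unfolding copy_reg_def using assms
    by (intro exec_eq[OF exec.Seq[OF _ exec_move_reg]]) (auto simp: S_def)
qed

text \<open>\<open>prod_encode (p, q)\<close> is \<open>triangle (p + q) + p\<close>. The first loop
  puts \<open>p\<close> into \<open>b\<close> and turns \<open>q\<close> into \<open>p + q\<close>;
  the second adds \<open>q\<close>, \<open>q - 1\<close>, ..., 1 to \<open>b\<close>.\<close>

definition encode_regs :: "nat \<Rightarrow> nat \<Rightarrow> nat \<Rightarrow> nat \<Rightarrow> prog" where
  "encode_regs b p q t =
     Seq (WhileNZ p (Seq (Dec p) (Seq (Inc b) (Inc q)))) (WhileNZ q (Seq (copy_reg q b t) (Dec q)))"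

lemma exec_encode_regs:
  assumes "distinct [b, p, q, t]" "\<sigma> t = 0" "\<sigma> b = 0"
  shows "exec (encode_regs b p q t) \<sigma> (\<sigma>(b := prod_encode (\<sigma> p, \<sigma> q), p := 0, q := 0))"
proof -
  define S where "S i = \<sigma>(p := i, b := \<sigma> p - i, q := \<sigma> q + (\<sigma> p - i))" for i
  have 1: "exec (WhileNZ p (Seq (Dec p) (Seq (Inc b) (Inc q)))) (S (\<sigma> p)) (S 0)"
  proof (rule exec_WhileNZ_family)
    fix i assume "i < \<sigma> p"
    then show "exec (Seq (Dec p) (Seq (Inc b) (Inc q))) (S (Suc i)) (S i)"
      using assms
      by (intro exec_eq[OF exec.Seq[OF exec.Dec exec.Seq[OF exec.Inc exec.Inc]]]) (auto simp: S_def fun_eq_iff)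
  qed (use assms in \<open>simp add: S_def\<close>)
  let ?n = "\<sigma> p + \<sigma> q"
  define T where "T i = \<sigma>(p := 0, b := \<sigma> p + (triangle ?n - triangle i), q := i)" for i
  have mono: "triangle i \<le> triangle j" if "i \<le> j" for i j
    unfolding triangle_def using that by (intro div_le_mono mult_le_mono) auto
  have 2: "exec (WhileNZ q (Seq (copy_reg q b t) (Dec q))) (T ?n) (T 0)"
  proof (rule exec_WhileNZ_family)
    fix i assume "i < ?n"
    then show "exec (Seq (copy_reg q b t) (Dec q)) (T (Suc i)) (T i)"
      using assms mono[of "Suc i" ?n]
      by (intro exec_eq[OF exec.Seq[OF exec_copy_reg exec.Dec]]) (auto simp: T_def fun_eq_iff)
  qed (use assms in \<open>simp add: T_def\<close>)
  have "S (\<sigma> p) = \<sigma>" "S 0 = T ?n" using assms by (auto simp: S_def T_def)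
  moreover have "T 0 = \<sigma>(b := prod_encode (\<sigma> p, \<sigma> q), p := 0, q := 0)"
    using assms by (auto simp: T_def prod_encode_def)
  ultimately show ?thesis
    using exec.Seq[OF 1] 2 unfolding encode_regs_def by simp
qed

text \<open>The successor moves one place along the Cantor diagonal, or to the start of the next
  diagonal. Decoding is therefore done by counting up from the pair \<open>(0, 0)\<close>.\<close>

lemma prod_decode_Suc:
  "prod_decode (Suc n) =
     (if snd (prod_decode n) = 0 then (0, Suc (fst (prod_decode n)))
      else (Suc (fst (prod_decode n)), snd (prod_decode n) - 1))"
proof -
  obtain p q where pq: "prod_decode n = (p, q)" by fastforce
  then have "n = prod_encode (p, q)" by (metis prod_decode_inverse)
  then have "prod_encode (if q = 0 then (0, Suc p) else (Suc p, q - 1)) = Suc n"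
    by (cases q) (auto simp: prod_encode_def)
  then have "prod_decode (Suc n) = (if q = 0 then (0, Suc p) else (Suc p, q - 1))"
    by (metis prod_encode_inverse)
  then show ?thesis by (simp add: pq)
qed

definition decode_reg :: "nat \<Rightarrow> nat \<Rightarrow> nat \<Rightarrow> prog" where
  "decode_reg b p q =
     WhileNZ b (Seq (Dec b) (IfNZ q (Seq (Dec q) (Inc p)) (Seq (move_reg p q) (Inc q))))"

lemma exec_decode_reg:
  assumes "distinct [b, p, q]" "\<sigma> p = 0" "\<sigma> q = 0"
  shows "exec (decode_reg b p q) \<sigma>
    (\<sigma>(b := 0, p := fst (prod_decode (\<sigma> b)), q := snd (prod_decode (\<sigma> b))))"
proof -
  define S where "S i = \<sigma>(b := i, p := fst (prod_decode (\<sigma> b - i)), q := snd (prod_decode (\<sigma> b - i)))"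
    for i
  have "exec (decode_reg b p q) (S (\<sigma> b)) (S 0)"
    unfolding decode_reg_def
  proof (rule exec_WhileNZ_family)
    fix i assume i: "i < \<sigma> b"
    let ?\<tau> = "(S (Suc i))(b := i)"
    have [simp]: "\<sigma> b - i = Suc (\<sigma> b - Suc i)" using i by simp
    have "exec (IfNZ q (Seq (Dec q) (Inc p)) (Seq (move_reg p q) (Inc q))) ?\<tau> (S i)"
    proof (cases "?\<tau> q = 0")
      case True
      then show ?thesis
        using assms
        by (intro exec.If_z exec_eq[OF exec.Seq[OF exec_move_reg exec.Inc]])
          (auto simp: S_def prod_decode_Suc)
    next
      case False
      then show ?thesis
        using assms
        by (intro exec.If_nz exec_eq[OF exec.Seq[OF exec.Dec exec.Inc]])
          (auto simp: S_def prod_decode_Suc)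
    qed
    then show "exec (Seq (Dec b) (IfNZ q (Seq (Dec q) (Inc p)) (Seq (move_reg p q) (Inc q))))
        (S (Suc i)) (S i)"
      using assms exec.Dec[of b "S (Suc i)"] by (intro exec.Seq[of _ _ ?\<tau>]) (auto simp: S_def)
  qed (use assms in \<open>simp add: S_def\<close>)
  moreover have "S (\<sigma> b) = \<sigma>" using assms by (auto simp: S_def prod_decode_def prod_decode_aux.simps)
  ultimately show ?thesis by (simp add: S_def)
qed

text \<open>
  The unary primitive recursive functions; several arguments are packed into one number by
  \<open>prod_encode\<close>.
\<close>

inductive PR :: "(nat \<Rightarrow> nat) \<Rightarrow> bool" where
  PR_id: "PR (\<lambda>x. x)"
| PR_0: "PR (\<lambda>x. 0)"
| PR_Suc0: "PR Suc"
| PR_fst0: "PR (\<lambda>x. fst (prod_decode x))"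
| PR_snd0: "PR (\<lambda>x. snd (prod_decode x))"
| PR_comp: "PR f \<Longrightarrow> PR g \<Longrightarrow> PR (\<lambda>x. f (g x))"
| PR_prod_encode: "PR f \<Longrightarrow> PR g \<Longrightarrow> PR (\<lambda>x. prod_encode (f x, g x))"
| PR_iter0: "PR f \<Longrightarrow> PR (\<lambda>x. (f ^^ fst (prod_decode x)) (snd (prod_decode x)))"

text \<open>The calling convention: registers above \<open>b\<close> are scratch, zero before and
  after; those below \<open>b\<close> are preserved and can hold saved values.\<close>

definition computes :: "nat \<Rightarrow> prog \<Rightarrow> (nat \<Rightarrow> nat) \<Rightarrow> bool" where
  "computes b c f \<longleftrightarrow> (\<forall>\<sigma>. (\<forall>j>b. \<sigma> j = 0) \<longrightarrow> exec c \<sigma> (\<sigma>(b := f (\<sigma> b))))"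

lemma computesD:
  "computes b c f \<Longrightarrow> (\<And>j. b < j \<Longrightarrow> \<sigma> j = 0) \<Longrightarrow> exec c \<sigma> (\<sigma>(b := f (\<sigma> b)))"
  by (simp add: computes_def)

text \<open>The base \<open>b\<close> varies in the induction, because a subprogram may have to work
  above registers that hold saved values.\<close>

lemma PR_computes: "PR f \<Longrightarrow> \<exists>c. computes b c f"
proof (induction arbitrary: b rule: PR.induct)
  case PR_id
  \<comment> \<open>A loop on the scratch register \<open>Suc b\<close>, which is 0, does
    nothing.\<close>
  have "computes b (WhileNZ (Suc b) (Inc 0)) (\<lambda>x. x)"
    by (simp add: computes_def exec.While_z)
  then show ?case by blast
next
  case PR_0
  have "computes b (clear b) (\<lambda>x. 0)"
    by (simp add: computes_def exec_clear)
  then show ?case by blast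
next
  case PR_Suc0
  have "computes b (Inc b) Suc"
    by (simp add: computes_def exec.Inc)
  then show ?case by blast
next
  case PR_fst0
  have "computes b (Seq (decode_reg b (b + 1) (b + 2)) (Seq (clear (b + 2)) (move_reg (b + 1) b)))
      (\<lambda>x. fst (prod_decode x))"
    unfolding computes_def
    by (auto intro!: exec_eq[OF exec.Seq[OF exec_decode_reg exec.Seq[OF exec_clear exec_move_reg]]])
  then show ?case by blast
next
  case PR_snd0
  have "computes b (Seq (decode_reg b (b + 1) (b + 2)) (Seq (clear (b + 1)) (move_reg (b + 2) b)))
      (\<lambda>x. snd (prod_decode x))"
    unfolding computes_def
    by (auto intro!: exec_eq[OF exec.Seq[OF exec_decode_reg exec.Seq[OF exec_clear exec_move_reg]]])
  then show ?case by blast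
next
  case (PR_comp f g)
  then obtain c d where cd: "computes b c f" "computes b d g" by metis
  have "computes b (Seq d c) (\<lambda>x. f (g x))"
    unfolding computes_def
    by (auto intro!: exec_eq[OF exec.Seq[OF cd(2)[THEN computesD] cd(1)[THEN computesD]]])
  then show ?case by blast
next
  case (PR_prod_encode f g)
  then obtain c d where cd: "computes (b + 1) c f" "computes (b + 2) d g" by metis
  have "computes b (Seq (copy_reg b (b + 1) (b + 2)) (Seq c (Seq (copy_reg b (b + 2) (b + 3)) (Seq d
      (Seq (clear b) (encode_regs b (b + 1) (b + 2) (b + 3))))))) (\<lambda>x. prod_encode (f x, g x))"
    unfolding computes_def
    by (auto intro!: exec_eq[OF exec.Seq[OF exec_copy_reg exec.Seq[OF cd(1)[THEN computesD]
      exec.Seq[OF exec_copy_reg exec.Seq[OF cd(2)[THEN computesD]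
      exec.Seq[OF exec_clear exec_encode_regs]]]]]])
  then show ?case by blast
next
  case (PR_iter0 f)
  then obtain c where c: "computes (b + 2) c f" by metis
  have loop: "exec (WhileNZ (b + 1) (Seq (Dec (b + 1)) c)) \<sigma>
      (\<sigma>(b + 1 := 0, b + 2 := (f ^^ \<sigma> (b + 1)) (\<sigma> (b + 2))))"
    if "\<And>j. b + 2 < j \<Longrightarrow> \<sigma> j = 0" for \<sigma>
  proof -
    define S where "S i = \<sigma>(b + 1 := i, b + 2 := (f ^^ (\<sigma> (b + 1) - i)) (\<sigma> (b + 2)))" for i
    have "exec (WhileNZ (b + 1) (Seq (Dec (b + 1)) c)) (S (\<sigma> (b + 1))) (S 0)"
    proof (rule exec_WhileNZ_family)
      fix i assume "i < \<sigma> (b + 1)"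
      then have [simp]: "\<sigma> (Suc b) - i = Suc (\<sigma> (Suc b) - Suc i)" by simp
      show "exec (Seq (Dec (b + 1)) c) (S (Suc i)) (S i)"
        by (intro exec_eq[OF exec.Seq[OF exec.Dec computesD[OF c]]]) (auto simp: S_def that)
    qed (simp add: S_def)
    moreover have "S (\<sigma> (b + 1)) = \<sigma>" by (auto simp: S_def)
    ultimately show ?thesis by (simp add: S_def)
  qed
  have "computes b (Seq (decode_reg b (b + 1) (b + 2)) (Seq (WhileNZ (b + 1) (Seq (Dec (b + 1)) c))
      (move_reg (b + 2) b))) (\<lambda>x. (f ^^ fst (prod_decode x)) (snd (prod_decode x)))"
    unfolding computes_def
    by (intro allI impI exec_eq[OF exec.Seq[OF exec_decode_reg exec.Seq[OF loop exec_move_reg]]]) auto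
  then show ?case by blast
qed

text \<open>The machine merges its two inputs into \<open>k + l + 1\<close>. Functions of this sum
  suffice for names, because accuracy and interval may both grow with it.\<close>

lemma PR_tm_computable:
  assumes "PR f"
  shows "tm_computable (\<lambda>k l. rat_poly_decode (f (k + l + 1)))"
proof -
  obtain c where c: "computes 0 c f" using PR_computes[OF assms] by blast
  let ?c = "Seq (Inc 0) c"
  let ?m = "num_regs ?c"
  have "tm_outputs (prog_tm ?m ?c) k l (f (k + l + 1))" for k l
    using prog_tm_outputs[OF computesD[OF c], of k l ?m] by simp
  moreover have "wf_tm (prog_tm ?m ?c)"
    by (rule wf_prog_tm) auto
  ultimately show ?thesis
    unfolding tm_computable_def by blast
qed

section \<open>Closure properties of the primitive recursive functions\<close>

named_theorems PR_intros

lemmas [PR_intros] = PR_id PR_prod_encode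

lemma PR_const [PR_intros]: "PR (\<lambda>x. c)"
proof (induction c)
  case (Suc c)
  show ?case using PR_comp[OF PR_Suc0 Suc] .
qed (rule PR_0)

lemma PR_Suc [PR_intros]: "PR f \<Longrightarrow> PR (\<lambda>x. Suc (f x))"
  by (rule PR_comp[OF PR_Suc0])

lemma PR_fst [PR_intros]: "PR f \<Longrightarrow> PR (\<lambda>x. fst (prod_decode (f x)))"
  by (rule PR_comp[OF PR_fst0])

lemma PR_snd [PR_intros]: "PR f \<Longrightarrow> PR (\<lambda>x. snd (prod_decode (f x)))"
  by (rule PR_comp[OF PR_snd0])

text \<open>
  In the rules for operators that bind variables, the body becomes a unary function by pairing the
  bound variables with the argument \<open>x\<close>.
\<close>

lemma PR_rec_nat [PR_intros]:
  assumes "PR a" "PR n"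
    "PR (\<lambda>y. s (fst (prod_decode y)) (fst (prod_decode (snd (prod_decode y))))
      (snd (prod_decode (snd (prod_decode y)))))"
  shows "PR (\<lambda>x. rec_nat (a x) (\<lambda>i r. s x i r) (n x))"
proof -
  define g where "g y = prod_encode (fst (prod_decode y),
      prod_encode (Suc (fst (prod_decode (snd (prod_decode y)))),
        s (fst (prod_decode y)) (fst (prod_decode (snd (prod_decode y))))
          (snd (prod_decode (snd (prod_decode y))))))" for y
  have g: "(g ^^ k) (prod_encode (x, prod_encode (0, r))) =
      prod_encode (x, prod_encode (k, rec_nat r (\<lambda>i r. s x i r) k))" for x k r
    by (induction k) (simp_all add: g_def)
  have "PR g"
    unfolding g_def by (intro PR_intros assms)
  then have "PR (\<lambda>x. snd (prod_decode (snd (prod_decode ((\<lambda>y. (g ^^ fst (prod_decode y)) (snd (prod_decode y)))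
      (prod_encode (n x, prod_encode (x, prod_encode (0, a x)))))))))"
    by (intro PR_intros PR_comp[OF PR_iter0] assms)
  then show ?thesis
    by (simp add: g)
qed

lemma PR_funpow [PR_intros]:
  assumes "PR a" "PR n" "PR (\<lambda>y. s (fst (prod_decode y)) (snd (prod_decode (snd (prod_decode y)))))"
  shows "PR (\<lambda>x. (s x ^^ n x) (a x))"
proof -
  have "rec_nat r (\<lambda>i. s x) k = (s x ^^ k) r" for x k r
    by (induction k) simp_all
  then show ?thesis
    using PR_rec_nat[OF assms(1,2), of "\<lambda>x i r. s x r"] assms(3) by simp
qed

lemma PR_case_nat [PR_intros]:
  assumes "PR n" "PR a" "PR (\<lambda>y. s (fst (prod_decode y)) (snd (prod_decode y)))"
  shows "PR (\<lambda>x. case n x of 0 \<Rightarrow> a x | Suc i \<Rightarrow> s x i)"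
proof -
  have "PR (\<lambda>x. rec_nat (a x) (\<lambda>i r. s x i) (n x))"
    by (intro PR_intros PR_comp[OF assms(3), of "\<lambda>y. prod_encode (fst (prod_decode y),
      fst (prod_decode (snd (prod_decode y))))", simplified] assms)
  moreover have "rec_nat (a x) (\<lambda>i r. s x i) (n x) = (case n x of 0 \<Rightarrow> a x | Suc i \<Rightarrow> s x i)" for x
    by (cases "n x") simp_all
  ultimately show ?thesis by simp
qed

lemma PR_add [PR_intros]:
  assumes "PR f" "PR g"
  shows "PR (\<lambda>x. f x + g x)"
proof -
  have "rec_nat b (\<lambda>i r. Suc r) a = a + b" for a b
    by (induction a) simp_all
  moreover have "PR (\<lambda>x. rec_nat (g x) (\<lambda>i r. Suc r) (f x))"
    by (intro PR_intros assms)
  ultimately show ?thesis by simp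
qed

lemma PR_mult [PR_intros]:
  assumes "PR f" "PR g"
  shows "PR (\<lambda>x. f x * g x)"
proof -
  have "rec_nat 0 (\<lambda>i r. b + r) a = a * b" for a b :: nat
    by (induction a) simp_all
  moreover have "PR (\<lambda>x. rec_nat 0 (\<lambda>i r. g x + r) (f x))"
    by (intro PR_intros assms PR_comp[OF assms(2)])
  ultimately show ?thesis by simp
qed

lemma PR_power [PR_intros]:
  assumes "PR f" "PR g"
  shows "PR (\<lambda>x. f x ^ g x)"
proof -
  have "rec_nat 1 (\<lambda>i r. b * r) a = b ^ a" for a b :: nat
    by (induction a) simp_all
  moreover have "PR (\<lambda>x. rec_nat 1 (\<lambda>i r. f x * r) (g x))"
    by (intro PR_intros assms PR_comp[OF assms(1)])
  ultimately show ?thesis by simp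
qed

lemma PR_fact [PR_intros]:
  assumes "PR f"
  shows "PR (\<lambda>x. fact (f x))"
proof -
  have "rec_nat 1 (\<lambda>i r. Suc i * r) a = fact a" for a :: nat
    by (induction a) (simp_all del: mult_Suc)
  moreover have "PR (\<lambda>x. rec_nat 1 (\<lambda>i r. Suc i * r) (f x))"
    by (intro PR_intros assms)
  ultimately show ?thesis by simp
qed

lemma PR_diff [PR_intros]:
  assumes "PR f" "PR g"
  shows "PR (\<lambda>x. f x - g x)"
proof -
  have *: "rec_nat b (\<lambda>i r. case r of 0 \<Rightarrow> 0 | Suc j \<Rightarrow> j) a = b - a" for a b :: nat
    by (induction a) (auto split: nat.splits)
  have "PR (\<lambda>x. rec_nat (f x) (\<lambda>i r. case r of 0 \<Rightarrow> 0 | Suc j \<Rightarrow> j) (g x))"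
    by (intro PR_intros assms)
  then show ?thesis by (simp only: *)
qed

lemma PR_sum [PR_intros]:
  assumes "PR n" "PR (\<lambda>y. s (fst (prod_decode y)) (snd (prod_decode y)))"
  shows "PR (\<lambda>x. \<Sum>i<n x. s x i)"
proof -
  have "rec_nat 0 (\<lambda>i r. r + s x i) a = (\<Sum>i<a. s x i)" for a x
    by (induction a) simp_all
  moreover have "PR (\<lambda>x. rec_nat 0 (\<lambda>i r. r + s x i) (n x))"
    by (intro PR_intros PR_comp[OF assms(2), of "\<lambda>y. prod_encode (fst (prod_decode y),
      fst (prod_decode (snd (prod_decode y))))", simplified] assms)
  ultimately show ?thesis by simp
qed

lemma PR_if_0 [PR_intros]:
  assumes "PR n" "PR f" "PR g"
  shows "PR (\<lambda>x. if n x = 0 then f x else g x)"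
proof -
  have "PR (\<lambda>x. case n x of 0 \<Rightarrow> f x | Suc i \<Rightarrow> g x)"
    by (intro PR_intros assms PR_comp[OF assms(3)])
  moreover have "(case n x of 0 \<Rightarrow> f x | Suc i \<Rightarrow> g x) = (if n x = 0 then f x else g x)" for x
    by (cases "n x") simp_all
  ultimately show ?thesis by simp
qed

lemma PR_if_le [PR_intros]:
  assumes "PR m" "PR n" "PR f" "PR g"
  shows "PR (\<lambda>x. if m x \<le> n x then f x else g x)"
proof -
  have "PR (\<lambda>x. if m x - n x = 0 then f x else g x)"
    by (intro PR_intros assms)
  then show ?thesis by simp
qed

lemma PR_div [PR_intros]:
  assumes "PR f" "PR g"
  shows "PR (\<lambda>x. f x div g x)"
proof -
  \<comment> \<open>\<open>a div b\<close> counts the positive multiples of \<open>b\<close> up to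
    \<open>a\<close>.\<close>
  have *: "(if b = 0 then 0 else \<Sum>i<a. if Suc i * b \<le> a then 1 else 0) = a div b" for a b :: nat
  proof (cases "b = 0")
    case False
    then have S: "Suc i * b \<le> a \<longleftrightarrow> Suc i \<le> a div b" for i
      by (intro less_eq_div_iff_mult_less_eq[symmetric]) simp
    have "i < a div b \<Longrightarrow> i < a" for i
      by (meson div_le_dividend less_le_trans)
    then have "{i. i < a \<and> Suc i * b \<le> a} = {..<a div b}"
      unfolding S by (auto simp: Suc_le_eq)
    moreover have "(\<Sum>i<a. if Suc i * b \<le> a then 1 else 0) = card {i. i < a \<and> Suc i * b \<le> a}"
      by (simp add: sum.If_cases Int_def del: mult_Suc)
    ultimately show ?thesis using False by (simp only: card_lessThan if_False)
  qed simp
  have "PR (\<lambda>x. if g x = 0 then 0 else \<Sum>i<f x. if Suc i * g x \<le> f x then 1 else 0)"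
    by (intro PR_intros assms PR_comp[OF assms(1)] PR_comp[OF assms(2)])
  then show ?thesis by (simp only: *)
qed

lemma PR_mod2 [PR_intros]:
  assumes "PR f"
  shows "PR (\<lambda>x. f x mod 2)"
proof -
  have "PR (\<lambda>x. f x - 2 * (f x div 2))"
    by (intro PR_intros assms)
  then show ?thesis by (simp only: minus_mult_div_eq_mod)
qed

lemma PR_choose [PR_intros]:
  assumes "PR f" "PR g"
  shows "PR (\<lambda>x. f x choose g x)"
proof -
  have *: "(if b \<le> a then fact a div (fact b * fact (a - b)) else 0) = (a choose b)" for a b
    using binomial_fact'[of b a] by (auto simp: binomial_eq_0)
  have "PR (\<lambda>x. if g x \<le> f x then fact (f x) div (fact (g x) * fact (f x - g x)) else 0)"
    by (intro PR_intros assms)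
  then show ?thesis by (simp only: *)
qed

lemma PR_list_encode_map [PR_intros]:
  assumes "PR n" "PR (\<lambda>y. s (fst (prod_decode y)) (snd (prod_decode y)))"
  shows "PR (\<lambda>x. list_encode (map (\<lambda>i. s x i) [0..<n x]))"
proof -
  \<comment> \<open>The list grows at its front, so the recursion runs through the indices from the
    last one down.\<close>
  have *: "rec_nat 0 (\<lambda>i r. Suc (prod_encode (s x (n x - Suc i), r))) k =
      list_encode (map (s x) [n x - k..<n x])" if "k \<le> n x" for k x
    using that
  proof (induction k)
    case (Suc k)
    then have "[n x - Suc k..<n x] = (n x - Suc k) # [n x - k..<n x]"
      by (simp add: upt_rec Suc_diff_Suc)
    with Suc show ?case by simp
  qed simp
  have "PR (\<lambda>x. rec_nat 0 (\<lambda>i r. Suc (prod_encode (s x (n x - Suc i), r))) (n x))"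
    by (intro PR_intros assms PR_comp[OF assms(1)] PR_comp[OF assms(2), of "\<lambda>y. prod_encode (fst (prod_decode y),
      n (fst (prod_decode y)) - Suc (fst (prod_decode (snd (prod_decode y)))))", simplified])
  then show ?thesis by (simp add: *)
qed

section \<open>Integer-valued primitive recursive functions\<close>

text \<open>Sums and products of such differences are again such differences without any case
  distinction on signs; only \<open>int_encode\<close> has to compare the two parts.\<close>

definition PR_int :: "(nat \<Rightarrow> int) \<Rightarrow> bool" where
  "PR_int f \<longleftrightarrow> (\<exists>p q. PR p \<and> PR q \<and> (\<forall>x. f x = int (p x) - int (q x)))"

named_theorems PR_int_intros

lemma PR_int_of_nat [PR_int_intros]: "PR f \<Longrightarrow> PR_int (\<lambda>x. int (f x))"
  unfolding PR_int_def by (rule exI[of _ f], rule exI[of _ "\<lambda>x. 0"]) (auto intro: PR_intros)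

lemma PR_int_mult [PR_int_intros]:
  assumes "PR_int f" "PR_int g"
  shows "PR_int (\<lambda>x. f x * g x)"
proof -
  obtain p q p' q' where pq: "PR p" "PR q" "PR p'" "PR q'"
    and f: "\<And>x. f x = int (p x) - int (q x)" and g: "\<And>x. g x = int (p' x) - int (q' x)"
    using assms unfolding PR_int_def by blast
  have "f x * g x = int (p x * p' x + q x * q' x) - int (p x * q' x + q x * p' x)" for x
    unfolding f g by (simp add: algebra_simps)
  moreover have "PR (\<lambda>x. p x * p' x + q x * q' x)" "PR (\<lambda>x. p x * q' x + q x * p' x)"
    by (intro PR_intros pq)+
  ultimately show ?thesis
    unfolding PR_int_def by blast
qed

lemma PR_int_minus_one_power [PR_int_intros]:
  assumes "PR f"
  shows "PR_int (\<lambda>x. (- 1) ^ f x)"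
proof -
  have "(- 1) ^ n = int (1 - n mod 2) - int (n mod 2)" for n
    by (cases "even n") (auto simp: mod_2_eq_odd)
  then show ?thesis
    unfolding PR_int_def using assms
    by (intro exI[of _ "\<lambda>x. 1 - f x mod 2"] exI[of _ "\<lambda>x. f x mod 2"]) (auto intro!: PR_intros)
qed

lemma PR_int_sum [PR_int_intros]:
  assumes "PR n" "PR_int (\<lambda>y. s (fst (prod_decode y)) (snd (prod_decode y)))"
  shows "PR_int (\<lambda>x. \<Sum>i<n x. s x i)"
proof -
  obtain p q where pq: "PR p" "PR q"
    and eq: "\<And>y. s (fst (prod_decode y)) (snd (prod_decode y)) = int (p y) - int (q y)"
    using assms unfolding PR_int_def by blast
  have "s x i = int (p (prod_encode (x, i))) - int (q (prod_encode (x, i)))" for x i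
    using eq[of "prod_encode (x, i)"] by simp
  then have "(\<Sum>i<n x. s x i) =
      int (\<Sum>i<n x. p (prod_encode (x, i))) - int (\<Sum>i<n x. q (prod_encode (x, i)))" for x
    by (simp add: sum_subtractf)
  moreover have "PR (\<lambda>x. \<Sum>i<n x. p (prod_encode (x, i)))" "PR (\<lambda>x. \<Sum>i<n x. q (prod_encode (x, i)))"
    using pq by (auto intro!: PR_intros assms)
  ultimately show ?thesis
    unfolding PR_int_def by blast
qed

lemma PR_int_encode [PR_intros]:
  assumes "PR_int f"
  shows "PR (\<lambda>x. int_encode (f x))"
proof -
  obtain p q where pq: "PR p" "PR q" and f: "\<And>x. f x = int (p x) - int (q x)"
    using assms unfolding PR_int_def by blast
  have *: "(if b \<le> a then 2 * (a - b) else Suc (2 * (b - a - 1))) = int_encode (int a - int b)"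
    for a b
    by (auto simp: int_encode_def sum_encode_def nat_diff_distrib' nat_eq_iff)
  have "PR (\<lambda>x. if q x \<le> p x then 2 * (p x - q x) else Suc (2 * (q x - p x - 1)))"
    by (intro PR_intros pq)
  then show ?thesis by (simp only: * f)
qed

section \<open>Simulation of Turing machines\<close>

text \<open>
  A number codes an infinite sequence of numbers that is eventually 0: \<open>prod_encode (x, c)\<close>
  codes the sequence coded by \<open>c\<close> with \<open>x\<close> in front, and 0 codes the constant sequence 0.
\<close>

definition stream_hd :: "nat \<Rightarrow> nat" where
  "stream_hd c = fst (prod_decode c)"

definition stream_tl :: "nat \<Rightarrow> nat" where
  "stream_tl c = snd (prod_decode c)"

definition stream_nth :: "nat \<Rightarrow> nat \<Rightarrow> nat" where
  "stream_nth c i = stream_hd ((stream_tl ^^ i) c)"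

lemma stream_hd_tl [simp]:
  "stream_hd (prod_encode (x, c)) = x" "stream_tl (prod_encode (x, c)) = c"
  by (simp_all add: stream_hd_def stream_tl_def)

lemma stream_nth_0: "stream_nth c 0 = stream_hd c"
  by (simp add: stream_nth_def)

lemma stream_nth_Suc: "stream_nth c (Suc i) = stream_nth (stream_tl c) i"
  by (simp add: stream_nth_def funpow_Suc_right del: funpow.simps)

lemma prod_decode_0: "prod_decode 0 = (0, 0)"
  by (simp add: prod_decode_def prod_decode_aux.simps)

lemma stream_nth_zero: "stream_nth 0 i = 0"
  by (induction i) (simp_all add: stream_nth_0 stream_nth_Suc stream_hd_def stream_tl_def prod_decode_0)

lemma stream_exists: "\<exists>c. \<forall>i<n. stream_nth c i = g i"
proof (induction n arbitrary: g)
  case (Suc n)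
  obtain c where "\<forall>i<n. stream_nth c i = g (Suc i)"
    using Suc[of "\<lambda>i. g (Suc i)"] by blast
  then have "\<forall>i<Suc n. stream_nth (prod_encode (g 0, c)) i = g i"
    by (auto simp: less_Suc_eq_0_disj stream_nth_0 stream_nth_Suc)
  then show ?case by blast
qed simp

lemma PR_stream_hd [PR_intros]: "PR f \<Longrightarrow> PR (\<lambda>x. stream_hd (f x))"
  unfolding stream_hd_def by (rule PR_fst)

lemma PR_stream_tl [PR_intros]: "PR f \<Longrightarrow> PR (\<lambda>x. stream_tl (f x))"
  unfolding stream_tl_def by (rule PR_snd)

lemma PR_stream_nth [PR_intros]: "PR f \<Longrightarrow> PR g \<Longrightarrow> PR (\<lambda>x. stream_nth (f x) (g x))"
  unfolding stream_nth_def by (intro PR_intros)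

section \<open>Codes of machines and configurations\<close>

fun move_code :: "move \<Rightarrow> nat" where
  "move_code Go_Left = 0"
| "move_code Go_Right = 1"
| "move_code Stay = 2"

text \<open>The value 0 is reserved for an undefined transition, so that halting is a test for
  0.\<close>

definition entry_code :: "(nat \<times> nat \<times> move) option \<Rightarrow> nat" where
  "entry_code e = (case e of None \<Rightarrow> 0
     | Some (q, s, m) \<Rightarrow> Suc (prod_encode (q, prod_encode (s, move_code m))))"

text \<open>Only the finitely many entries for actual states and symbols are prescribed, so every
  machine has a code.\<close>

definition codes_tm :: "nat \<Rightarrow> turing_machine \<Rightarrow> bool" where
  "codes_tm e M \<longleftrightarrow> (\<forall>q < n_states M. \<forall>s < n_symbols M.
     stream_nth e (prod_encode (q, s)) = entry_code (trans M q s))"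

lemma codes_tm_exists: "\<exists>e. codes_tm e M"
proof -
  let ?A = "prod_encode ` ({..<n_states M} \<times> {..<n_symbols M})"
  obtain n where n: "\<And>i. i \<in> ?A \<Longrightarrow> i < n"
    using finite_nat_set_iff_bounded[of ?A] by blast
  obtain e where "\<forall>i<n. stream_nth e i = (case prod_decode i of (q, s) \<Rightarrow> entry_code (trans M q s))"
    using stream_exists[of n "\<lambda>i. case prod_decode i of (q, s) \<Rightarrow> entry_code (trans M q s)"] by blast
  moreover have "prod_encode (q, s) < n" if "q < n_states M" "s < n_symbols M" for q s
    using that by (intro n) auto
  ultimately have "codes_tm e M"
    unfolding codes_tm_def by simp
  then show ?thesis ..
qed

text \<open>A configuration is coded by its state, the cells left of the head by increasing
  distance, and the cells from the head rightwards. A step then only changes the fronts of the two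
  streams.\<close>

definition conf_state :: "nat \<Rightarrow> nat" where
  "conf_state c = stream_hd c"

definition conf_left :: "nat \<Rightarrow> nat" where
  "conf_left c = stream_hd (stream_tl c)"

definition conf_right :: "nat \<Rightarrow> nat" where
  "conf_right c = stream_tl (stream_tl c)"

definition make_conf :: "nat \<Rightarrow> nat \<Rightarrow> nat \<Rightarrow> nat" where
  "make_conf q L R = prod_encode (q, prod_encode (L, R))"

lemma conf_simps [simp]:
  "conf_state (make_conf q L R) = q" "conf_left (make_conf q L R) = L"
  "conf_right (make_conf q L R) = R"
  by (simp_all add: conf_state_def conf_left_def conf_right_def make_conf_def)

definition conf_entry :: "nat \<Rightarrow> nat \<Rightarrow> nat" where
  "conf_entry e c = stream_nth e (prod_encode (conf_state c, stream_hd (conf_right c)))"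

definition conf_action :: "nat \<Rightarrow> nat \<Rightarrow> nat \<Rightarrow> nat \<Rightarrow> nat" where
  "conf_action c q s m =
     (if m = 0 then make_conf q (stream_tl (conf_left c))
        (prod_encode (stream_hd (conf_left c), prod_encode (s, stream_tl (conf_right c))))
      else if m \<le> 1 then make_conf q (prod_encode (s, conf_left c)) (stream_tl (conf_right c))
      else make_conf q (conf_left c) (prod_encode (s, stream_tl (conf_right c))))"

definition conf_step :: "nat \<Rightarrow> nat \<Rightarrow> nat" where
  "conf_step e c = (case conf_entry e c of 0 \<Rightarrow> c
     | Suc i \<Rightarrow> conf_action c (stream_hd i) (stream_hd (stream_tl i)) (stream_tl (stream_tl i)))"

text \<open>The run of the machine with code \<open>e\<close> on the input pair \<open>(0, e)\<close>.\<close>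

definition conf_run :: "nat \<Rightarrow> nat \<Rightarrow> nat" where
  "conf_run e n = (conf_step e ^^ n)
     (make_conf 0 0 (prod_encode (0, ((\<lambda>c. prod_encode (1, c)) ^^ e) 0)))"

definition halts_at :: "nat \<Rightarrow> nat \<Rightarrow> bool" where
  "halts_at e n \<longleftrightarrow> conf_entry e (conf_run e n) = 0 \<and> (\<forall>i<n. conf_entry e (conf_run e i) \<noteq> 0)"

lemma halts_at_unique: "halts_at e m \<Longrightarrow> halts_at e n \<Longrightarrow> m = n"
  unfolding halts_at_def by (metis linorder_neqE_nat)

lemma PR_conf_state [PR_intros]: "PR f \<Longrightarrow> PR (\<lambda>x. conf_state (f x))"
  unfolding conf_state_def by (intro PR_intros)

lemma PR_conf_left [PR_intros]: "PR f \<Longrightarrow> PR (\<lambda>x. conf_left (f x))"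
  unfolding conf_left_def by (intro PR_intros)

lemma PR_conf_right [PR_intros]: "PR f \<Longrightarrow> PR (\<lambda>x. conf_right (f x))"
  unfolding conf_right_def by (intro PR_intros)

lemma PR_make_conf [PR_intros]:
  "PR f \<Longrightarrow> PR g \<Longrightarrow> PR h \<Longrightarrow> PR (\<lambda>x. make_conf (f x) (g x) (h x))"
  unfolding make_conf_def by (intro PR_intros)

lemma PR_conf_entry [PR_intros]: "PR f \<Longrightarrow> PR g \<Longrightarrow> PR (\<lambda>x. conf_entry (f x) (g x))"
  unfolding conf_entry_def by (intro PR_intros)

lemma PR_conf_action [PR_intros]:
  "PR f \<Longrightarrow> PR g \<Longrightarrow> PR h \<Longrightarrow> PR k \<Longrightarrow> PR (\<lambda>x. conf_action (f x) (g x) (h x) (k x))"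
  unfolding conf_action_def by (intro PR_intros)

lemma PR_conf_step [PR_intros]:
  assumes "PR f" "PR g"
  shows "PR (\<lambda>x. conf_step (f x) (g x))"
  unfolding conf_step_def by (intro PR_intros assms PR_comp[OF assms(2)])

lemma PR_conf_run [PR_intros]:
  assumes "PR f" "PR g"
  shows "PR (\<lambda>x. conf_run (f x) (g x))"
  unfolding conf_run_def by (intro PR_intros assms PR_comp[OF assms(1)])

text \<open>Halting at exactly a given time is decided by a bounded simulation; that no earlier halt
  occurs is expressed by a vanishing sum of indicators.\<close>

lemma PR_halts_at [PR_intros]:
  assumes "PR f" "PR g"
  shows "PR (\<lambda>x. of_bool (halts_at (f x) (g x)))"
proof -
  have *: "of_bool (halts_at e n) = (if conf_entry e (conf_run e n) = 0 then
      if (\<Sum>i<n. if conf_entry e (conf_run e i) = 0 then 1 else 0) = (0::nat) then 1 else 0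
      else 0)" for e n
    by (auto simp: halts_at_def)
  show ?thesis
    unfolding * by (intro PR_intros assms PR_comp[OF assms(1)])
qed

text \<open>The bounds on state and symbols ensure that \<open>codes_tm\<close> determines the entry
  that is looked up.\<close>

definition codes_conf :: "turing_machine \<Rightarrow> nat \<Rightarrow> tm_config \<Rightarrow> bool" where
  "codes_conf M c = (\<lambda>(q, h, t). q < n_states M \<and> (\<forall>i. t i < n_symbols M) \<and> conf_state c = q \<and>
     (\<forall>i. stream_nth (conf_left c) i = t (h - 1 - int i)) \<and>
     (\<forall>i. stream_nth (conf_right c) i = t (h + int i)))"

lemma codes_conf_entry:
  assumes "codes_tm e M" "codes_conf M c (q, h, t)"
  shows "conf_entry e c = entry_code (trans M q (t h))"
proof -
  have "stream_hd (conf_right c) = t h" "q < n_states M" "t h < n_symbols M" "conf_state c = q"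
    using assms(2) by (auto simp: codes_conf_def simp flip: stream_nth_0)
  then show ?thesis
    using assms(1) by (simp add: codes_tm_def conf_entry_def)
qed

lemma stream_nth_prod_encode:
  "stream_nth (prod_encode (x, c)) i = (case i of 0 \<Rightarrow> x | Suc j \<Rightarrow> stream_nth c j)"
  by (cases i) (simp_all add: stream_nth_0 stream_nth_Suc)

lemma stream_nth_tl: "stream_nth (stream_tl c) i = stream_nth c (Suc i)"
  by (simp add: stream_nth_Suc)

lemma codes_conf_step:
  assumes "wf_tm M" "codes_tm e M" "codes_conf M c C" "tm_step M C = Some C'"
  shows "codes_conf M (conf_step e c) C' \<and> conf_entry e c \<noteq> 0"
proof -
  obtain q h t where C: "C = (q, h, t)" by (cases C)
  obtain q' s' m where tr: "trans M q (t h) = Some (q', s', m)"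
    and C': "C' = (q', h + shift m, t(h := s'))"
    using assms(4) C by (auto split: option.splits)
  have entry: "conf_entry e c = Suc (prod_encode (q', prod_encode (s', move_code m)))"
    using codes_conf_entry[OF assms(2) assms(3)[unfolded C]] tr by (simp add: entry_code_def)
  have step: "conf_step e c = conf_action c q' s' (move_code m)"
    by (simp add: conf_step_def entry)
  have qs: "q' < n_states M" "s' < n_symbols M"
    using assms(1,3) tr unfolding wf_tm_def codes_conf_def C by blast+
  have L: "stream_nth (conf_left c) i = t (h - 1 - int i)"
    and R: "stream_nth (conf_right c) i = t (h + int i)" for i
    using assms(3) by (auto simp: codes_conf_def C)
  have L0: "stream_hd (conf_left c) = t (h - 1)"
    using L[of 0] by (simp add: stream_nth_0)
  have "codes_conf M (conf_action c q' s' (move_code m)) C'"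
    using qs assms(3) unfolding C C' codes_conf_def
    by (cases m) (auto simp: conf_action_def stream_nth_prod_encode stream_nth_tl L R L0
        algebra_simps split: nat.splits)
  then show ?thesis
    by (simp add: step entry)
qed

lemma conf_run_Suc: "conf_run e (Suc n) = conf_step e (conf_run e n)"
  by (simp add: conf_run_def)

lemma stream_nth_ones: "stream_nth (((\<lambda>c. prod_encode (1, c)) ^^ n) 0) i = (if i < n then 1 else 0)"
  by (induction n arbitrary: i) (auto simp: stream_nth_zero stream_nth_prod_encode split: nat.splits)

text \<open>Besides the simulation, the induction counts nonblank cells: the input has
  \<open>e\<close> of them, and each step writes to one cell only.\<close>

lemma codes_conf_run:
  assumes M: "wf_tm M" "codes_tm e M"
    and "((\<lambda>c c'. tm_step M c = Some c') ^^ n) (0, 0, pair_tape 0 e) (q, h, t)"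
  shows "codes_conf M (conf_run e n) (q, h, t) \<and> (\<forall>i<n. conf_entry e (conf_run e i) \<noteq> 0) \<and>
    finite {i. t i \<noteq> 0} \<and> card {i. t i \<noteq> 0} \<le> e + n"
  using assms(3)
proof (induction n arbitrary: q h t)
  case 0
  \<comment> \<open>With first input 0 the separating blank is cell 0, so the strokes begin at cell
    1.\<close>
  have supp: "{i. pair_tape 0 e i \<noteq> 0} = {0<..int e}"
    by (auto simp: pair_tape_def)
  have "codes_conf M (conf_run e 0) (0, 0, pair_tape 0 e)"
    using M(1)
    by (auto simp: conf_run_def codes_conf_def wf_tm_def pair_tape_def stream_nth_zero
        stream_nth_prod_encode stream_nth_ones[unfolded One_nat_def] Suc_le_eq
        split: nat.splits)
  then show ?case
    using 0 supp by simp
next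
  case (Suc n)
  obtain q0 h0 t0 where run: "((\<lambda>c c'. tm_step M c = Some c') ^^ n) (0, 0, pair_tape 0 e) (q0, h0, t0)"
    and step: "tm_step M (q0, h0, t0) = Some (q, h, t)"
    using Suc.prems by auto
  note IH = Suc.IH[OF run]
  have "codes_conf M (conf_run e (Suc n)) (q, h, t)" "conf_entry e (conf_run e n) \<noteq> 0"
    using codes_conf_step[OF M _ step, of "conf_run e n"] IH by (auto simp: conf_run_Suc)
  moreover have sub: "{i. t i \<noteq> 0} \<subseteq> insert h0 {i. t0 i \<noteq> 0}"
    using step by (auto split: option.splits if_splits)
  then have "finite {i. t i \<noteq> 0}"
    by (rule finite_subset) (use IH in simp)
  moreover have "card {i. t i \<noteq> 0} \<le> card (insert h0 {i. t0 i \<noteq> 0})"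
    by (rule card_mono[OF _ sub]) (use IH in simp)
  then have "card {i. t i \<noteq> 0} \<le> e + Suc n"
    using IH by (simp add: card_insert_if split: if_splits)
  ultimately show ?case
    using IH by (auto simp: less_Suc_eq)
qed

text \<open>The \<open>n\<close> strokes of the output are nonblank cells, of which there are at
  most \<open>e + s\<close>.\<close>

lemma halts_at_output:
  assumes M: "wf_tm M" "codes_tm e M" and "tm_outputs M 0 e n"
  shows "\<exists>s. halts_at e s \<and> n \<le> e + s"
proof -
  obtain q h t where reach: "tm_reaches M (0, 0, pair_tape 0 e) (q, h, t)"
    and halt: "tm_step M (q, h, t) = None" and out: "\<forall>i < n. t (h + int i) = 1"
    using assms(3) unfolding tm_outputs_def by blast
  obtain s where s: "((\<lambda>c c'. tm_step M c = Some c') ^^ s) (0, 0, pair_tape 0 e) (q, h, t)"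
    using reach unfolding tm_reaches_def by (auto dest: rtranclp_imp_relpowp)
  note run = codes_conf_run[OF M s]
  have "conf_entry e (conf_run e s) = 0"
    using codes_conf_entry[OF M(2)] run halt
    by (auto simp: entry_code_def split: option.splits)
  moreover have "(\<lambda>i. h + int i) ` {..<n} \<subseteq> {i. t i \<noteq> 0}"
    using out by auto
  then have "card ((\<lambda>i. h + int i) ` {..<n}) \<le> card {i. t i \<noteq> 0}"
    using run by (intro card_mono) auto
  then have "n \<le> card {i. t i \<noteq> 0}"
    by (simp add: card_image inj_on_def)
  ultimately show ?thesis
    using run unfolding halts_at_def by (intro exI[of _ s]) auto
qed

section \<open>Series of Gaussian bumps\<close>

text \<open>The factor \<open>u ^ 4\<close> makes the bump so narrow that its slope at the centre is
  \<open>u\<close> although its size is at most \<open>1 / u\<close>. The type is polymorphic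
  because computability concerns the real function and smoothness its complex extension.\<close>

definition bump :: "nat \<Rightarrow> nat \<Rightarrow> 'a::{real_normed_field,banach} \<Rightarrow> 'a" where
  "bump u e z = of_nat u * (z - of_nat e) * exp (- (of_nat u ^ 4 * (z - of_nat e)\<^sup>2))"

definition bump_deriv :: "nat \<Rightarrow> nat \<Rightarrow> 'a::{real_normed_field,banach} \<Rightarrow> 'a" where
  "bump_deriv u e z = of_nat u * (1 - 2 * (of_nat u ^ 4 * (z - of_nat e)\<^sup>2)) *
     exp (- (of_nat u ^ 4 * (z - of_nat e)\<^sup>2))"

lemma bump_0 [simp]: "bump 0 e z = 0"
  by (simp add: bump_def)

lemma bump_of_real: "bump u e (of_real x) = of_real (bump u e x)"
  by (simp add: bump_def flip: exp_of_real)

lemma bump_deriv_of_real: "bump_deriv u e (of_real x) = of_real (bump_deriv u e x)"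
  by (simp add: bump_deriv_def flip: exp_of_real)

lemma has_field_derivative_bump:
  "(bump u e has_field_derivative bump_deriv u e z) (at z)"
  unfolding bump_def[abs_def] bump_deriv_def
  by (auto intro!: derivative_eq_intros simp: algebra_simps power2_eq_square)

text \<open>In terms of \<open>y = u ^ 2 * \<bar>x - e\<bar>\<close> the absolute value is
  \<open>y * exp (- y ^ 2) / u\<close>.\<close>

lemma abs_bump_le:
  fixes x :: real
  assumes "0 < u"
  shows "\<bar>bump u e x\<bar> \<le> 1 / u"
proof -
  define y where "y = real u ^ 2 * \<bar>x - real e\<bar>"
  have "0 \<le> y" by (simp add: y_def)
  then have "y \<le> 1 + y\<^sup>2"
    using zero_le_power2[of "y - 1"] unfolding power2_diff by simp
  also have "\<dots> \<le> exp (y\<^sup>2)"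
    by (rule exp_ge_add_one_self)
  finally have "y * exp (- y\<^sup>2) \<le> 1"
    by (simp add: exp_minus field_simps)
  moreover have "\<bar>bump u e x\<bar> * u = y * exp (- y\<^sup>2)"
    by (simp add: bump_def y_def abs_mult power_mult_distrib power2_eq_square power4_eq_xxxx mult_ac)
  ultimately show ?thesis
    using assms by (simp add: field_simps)
qed

text \<open>A Gaussian grows in imaginary directions. A centre \<open>e \<ge> 2 * R + 1\<close> is
  so far from the disc that the real part of \<open>(z - e) ^ 2\<close> is at least
  \<open>e\<close>, which restores the decay.\<close>

lemma norm_bump_le:
  fixes z :: complex
  assumes "0 < u" "norm z \<le> R" "2 * R + 1 \<le> real e"
  shows "norm (bump u e z) \<le> 2 / u"
proof -
  have R: "0 \<le> R" using assms(2) norm_ge_zero order_trans by blast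
  have e: "1 \<le> real e" using assms R by linarith
  have "(cmod z)\<^sup>2 = (Re z)\<^sup>2 + (Im z)\<^sup>2" by (rule cmod_power2)
  then have im: "(Im z)\<^sup>2 \<le> R\<^sup>2"
    using power_mono[OF assms(2) norm_ge_zero, of 2] zero_le_power2[of "Re z"] by linarith
  have re: "\<bar>Re z\<bar> \<le> R" using abs_Re_le_cmod[of z] assms(2) by linarith
  have "real e * 1 \<le> real e * (real e - 2 * R)"
    using assms(3) by (intro mult_left_mono) auto
  also have "\<dots> = (real e - R)\<^sup>2 - R\<^sup>2"
    by (simp add: power2_eq_square algebra_simps)
  also have "\<dots> \<le> (Re z - real e)\<^sup>2 - (Im z)\<^sup>2"
  proof -
    have "(real e - R)\<^sup>2 \<le> (real e - Re z)\<^sup>2"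
      using re assms(3) R by (intro power_mono) linarith+
    then show ?thesis using im by (simp add: power2_commute)
  qed
  finally have Re: "real e \<le> (Re z - real e)\<^sup>2 - (Im z)\<^sup>2" by simp
  define y where "y = real u ^ 4 * real e"
  have y: "0 < y" using assms(1) e by (simp add: y_def)
  have "norm (exp (- (of_nat u ^ 4 * (z - of_nat e)\<^sup>2))) =
      exp (- (real u ^ 4 * ((Re z - real e)\<^sup>2 - (Im z)\<^sup>2)))"
  proof -
    have "Re (of_nat u ^ 4 * (z - of_nat e)\<^sup>2) = real u ^ 4 * ((Re z - real e)\<^sup>2 - (Im z)\<^sup>2)"
      by (simp add: Re_power2 flip: of_nat_power)
    then show ?thesis by (simp add: norm_exp_eq_Re)
  qed
  also have "\<dots> \<le> exp (- y)"
    using Re by (simp add: y_def mult_left_mono)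
  also have "\<dots> \<le> 1 / y"
    using y exp_ge_add_one_self[of y] by (simp add: exp_minus field_simps del: exp_ge_add_one_self)
  finally have 1: "norm (exp (- (of_nat u ^ 4 * (z - of_nat e)\<^sup>2))) \<le> 1 / y" .
  have "norm (z - of_nat e) \<le> 2 * real e"
    using norm_triangle_ineq4[of z "of_nat e"] assms R by simp
  then have "norm (bump u e z) \<le> u * (2 * real e) * (1 / y)"
    unfolding bump_def norm_mult using 1 by (intro mult_mono) auto
  also have "\<dots> = 2 / real u ^ 3"
    using e assms(1) by (simp add: y_def field_simps power_numeral_reduce)
  also have "\<dots> \<le> 2 / u"
    using assms(1) self_le_power[of "real u" 3] by (intro divide_left_mono) auto
  finally show ?thesis .
qed

lemma bump_deriv_center: "bump_deriv u e (of_nat e) = of_nat u"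
  by (simp add: bump_deriv_def)

text \<open>Another integer has distance at least 1 from the centre, so the exponent
  \<open>y\<close> is at least \<open>u ^ 2\<close>, and \<open>y ^ 2 \<le> 2 * exp y\<close>
  outweighs the factors \<open>u\<close> and \<open>y\<close>.\<close>

lemma abs_bump_deriv_le:
  assumes "0 < u" "d \<noteq> e"
  shows "\<bar>bump_deriv u e (real d)\<bar> \<le> 4 / u"
proof -
  define y where "y = real u ^ 4 * (real d - real e)\<^sup>2"
  have "1 \<le> \<bar>real d - real e\<bar>" using assms(2) by linarith
  then have d: "1 \<le> (real d - real e)\<^sup>2"
    using one_le_power[of "\<bar>real d - real e\<bar>" 2] by simp
  have u: "1 \<le> real u" using assms(1) by simp
  have "real u ^ 4 * 1 \<le> y"
    unfolding y_def using d by (intro mult_left_mono) auto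
  moreover have "real u ^ 2 \<le> real u ^ 4"
    using u by (intro power_increasing) auto
  ultimately have yu: "real u ^ 2 \<le> y" by linarith
  have y1: "1 \<le> y" using yu one_le_power[OF u, of 2] by linarith
  have "y\<^sup>2 \<le> 2 * exp y"
    using exp_lower_Taylor_quadratic[of y] y1 by linarith
  then have y: "y * exp (- y) \<le> 2 / y"
    using y1 by (simp add: exp_minus field_simps power2_eq_square)
  have "\<bar>bump_deriv u e (real d)\<bar> = u * (2 * y - 1) * exp (- y)"
    using y1 by (simp add: bump_deriv_def abs_mult flip: y_def)
  also have "\<dots> \<le> 2 * u * (y * exp (- y))"
    using u by (simp add: algebra_simps)
  also have "\<dots> \<le> 2 * u * (2 / y)"
    using y by (intro mult_left_mono) auto
  also have "\<dots> \<le> 4 / u"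
    using yu y1 u by (simp add: field_simps power2_eq_square)
  finally show ?thesis .
qed

section \<open>Taylor approximation of a bump\<close>

text \<open>Lagrange remainder. Since \<open>(2 * y) ^ N / fact N\<close> is a single term of the
  series of \<open>exp (2 * y)\<close>, the error is at most \<open>exp (3 * y) / 2 ^ N\<close>; the
  5 comes from \<open>exp 1 ^ 3 \<le> 27 \<le> 2 ^ 5\<close>.\<close>

lemma exp_Taylor_error:
  fixes y :: real
  assumes "0 \<le> y" "y \<le> real Y"
  shows "\<bar>exp (- y) - (\<Sum>i<N. (- y) ^ i / fact i)\<bar> \<le> 2 ^ (5 * Y) / 2 ^ N"
proof -
  obtain t where t: "\<bar>t\<bar> \<le> \<bar>- y\<bar>"
    and eq: "exp (- y) = (\<Sum>i<N. (- y) ^ i / fact i) + exp t / fact N * (- y) ^ N"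
    using Maclaurin_exp_le by blast
  have "(2 * y) ^ N / fact N = sum (\<lambda>i. inverse (fact i) * (2 * y) ^ i) {N}"
    by (simp add: field_simps)
  also have "\<dots> \<le> (\<Sum>i. inverse (fact i) * (2 * y) ^ i)"
    using assms by (intro sum_le_suminf summable_exp) auto
  also have "\<dots> = exp (2 * y)"
    by (simp add: exp_def scaleR_conv_of_real)
  finally have "y ^ N / fact N \<le> exp (2 * y) / 2 ^ N"
    by (simp add: power_mult_distrib field_simps)
  moreover have "\<bar>exp (- y) - (\<Sum>i<N. (- y) ^ i / fact i)\<bar> = exp t * (y ^ N / fact N)"
    using assms by (simp add: eq abs_mult power_abs)
  moreover have "exp t \<le> exp y"
    using t assms(1) by simp
  ultimately have "\<bar>exp (- y) - (\<Sum>i<N. (- y) ^ i / fact i)\<bar> \<le> exp y * (exp (2 * y) / 2 ^ N)"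
    using assms by (simp only:) (intro mult_mono, auto)
  also have "\<dots> = exp (3 * y) / 2 ^ N"
    by (simp flip: exp_add)
  also have "exp (3 * y) \<le> exp (real Y * 3)"
    using assms by simp
  also have "\<dots> = (exp 1 ^ 3) ^ Y"
    by (simp add: exp_of_nat_mult flip: exp_of_nat2_mult power_mult)
  also have "\<dots> \<le> (3 ^ 3) ^ Y"
    using exp_le by (intro power_mono) auto
  also have "\<dots> \<le> (2 ^ 5) ^ Y"
    by (intro power_mono) auto
  finally show ?thesis
    by (simp add: divide_right_mono power_mult)
qed

definition bump_Taylor :: "nat \<Rightarrow> nat \<Rightarrow> nat \<Rightarrow> real \<Rightarrow> real" where
  "bump_Taylor N u e x = u * (x - e) * (\<Sum>i<N. (- (real u ^ 4 * (x - e)\<^sup>2)) ^ i / fact i)"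

lemma bump_Taylor_error:
  assumes "\<bar>x - real e\<bar> \<le> real X" "u \<le> V"
  shows "\<bar>bump u e x - bump_Taylor N u e x\<bar> \<le> real (V * X) * 2 ^ (5 * (V ^ 4 * X\<^sup>2)) / 2 ^ N"
proof -
  let ?y = "real u ^ 4 * (x - real e)\<^sup>2"
  have "(x - real e)\<^sup>2 \<le> real X ^ 2"
    using power_mono[OF assms(1), of 2] by simp
  then have "?y \<le> real (V ^ 4 * X\<^sup>2)"
    using assms(2) unfolding of_nat_mult of_nat_power
    by (intro mult_mono[OF power_mono]) auto
  then have "\<bar>exp (- ?y) - (\<Sum>i<N. (- ?y) ^ i / fact i)\<bar> \<le> 2 ^ (5 * (V ^ 4 * X\<^sup>2)) / 2 ^ N"
    by (intro exp_Taylor_error) auto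
  moreover have "\<bar>bump u e x - bump_Taylor N u e x\<bar> =
      u * \<bar>x - e\<bar> * \<bar>exp (- ?y) - (\<Sum>i<N. (- ?y) ^ i / fact i)\<bar>"
    unfolding bump_def bump_Taylor_def
    by (simp only: right_diff_distrib[symmetric] abs_mult abs_of_nat)
  moreover have "u * \<bar>x - e\<bar> \<le> real (V * X)"
    using assms unfolding of_nat_mult by (intro mult_mono) auto
  ultimately show ?thesis
    by (simp only: times_divide_eq_right[symmetric]) (intro mult_mono, auto)
qed

section \<open>Smoothness and derivative of the series\<close>

lemma Re_holomorphic_has_derivative:
  assumes "(F has_field_derivative D) (at (of_real x))"
  shows "((\<lambda>x. Re (F (of_real x))) has_real_derivative Re D) (at x)"
  using has_vector_derivative_real_field[OF assms]
  by (auto simp: has_real_derivative_iff_has_vector_derivative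
      intro: bounded_linear.has_vector_derivative[OF bounded_linear_Re])

text \<open>All complex derivatives exist, and taking real parts along the real axis commutes with
  differentiation.\<close>

lemma Re_holomorphic_Cinf:
  assumes "F holomorphic_on UNIV"
  shows "(\<lambda>x. Re (F (of_real x))) \<in> Cinf_fun"
proof -
  have D: "((\<lambda>x. Re ((deriv ^^ n) F (of_real x))) has_real_derivative
      Re ((deriv ^^ Suc n) F (of_real x))) (at x)" for n x
  proof -
    have "(deriv ^^ n) F field_differentiable at (of_real x)"
      using holomorphic_higher_deriv[OF assms, of n] by (simp add: holomorphic_on_def)
    then show ?thesis
      by (intro Re_holomorphic_has_derivative) (simp add: DERIV_deriv_iff_field_differentiable)
  qed
  have "(deriv ^^ n) (\<lambda>x. Re (F (of_real x))) = (\<lambda>x. Re ((deriv ^^ n) F (of_real x)))" for n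
  proof (induction n)
    case (Suc n)
    have "deriv (\<lambda>x. Re ((deriv ^^ n) F (of_real x))) = (\<lambda>x. Re ((deriv ^^ Suc n) F (of_real x)))"
      by (rule ext) (rule DERIV_imp_deriv[OF D])
    with Suc show ?case by simp
  qed simp
  then show ?thesis
    unfolding Cinf_fun_def differentiable_on_def
    using D by (auto simp: real_differentiable_def)
qed

text \<open>The value 0 stands for a missing bump; the growth of the other values makes the
  contributions of all bumps summable.\<close>

locale bump_series =
  fixes u :: "nat \<Rightarrow> nat"
  assumes heights: "u e = 0 \<or> 4 ^ (e + 2) \<le> u e"
begin

definition series :: "'a::{real_normed_field,banach} \<Rightarrow> 'a" where
  "series z = (\<Sum>e. bump (u e) e z)"

lemma inverse_height: "u e \<noteq> 0 \<Longrightarrow> 1 / real (u e) \<le> (1 / 4) ^ (e + 2)"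
  using heights[of e] of_nat_le_iff[of "4 ^ (e + 2)" "u e", where ?'a = real]
  by (simp add: field_simps)

lemma summable_bump: "summable (\<lambda>e. bump (u e) e (x::real))"
proof (rule summable_comparison_test)
  have "\<bar>bump (u e) e x\<bar> \<le> (1 / 4) ^ e" for e
  proof (cases "u e = 0")
    case False
    then show ?thesis
      using abs_bump_le[of "u e" e x] inverse_height[of e] power_decreasing[of e "e + 2" "1 / 4 :: real"]
      by simp
  qed simp
  then show "\<exists>N. \<forall>e\<ge>N. norm (bump (u e) e x) \<le> (1 / 4) ^ e"
    by auto
qed (simp add: summable_geometric)

lemma series_of_real: "series (of_real x :: complex) = of_real (series x)"
  unfolding series_def by (simp add: bump_of_real suminf_of_real[OF summable_bump])

lemma uniform_limit_series:
  "uniform_limit (cball 0 R) (\<lambda>n z. \<Sum>e<n. bump (u e) e z) (series :: complex \<Rightarrow> complex) sequentially"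
  unfolding series_def[abs_def]
proof (rule Weierstrass_m_test_ev)
  \<comment> \<open>The finitely many bumps with centres near the disc do not affect convergence;
    hence the M-test with eventual bounds.\<close>
  have "norm (bump (u e) e z) \<le> (1 / 4) ^ e"
    if "nat \<lceil>2 * R + 1\<rceil> \<le> e" "z \<in> cball 0 R" for e and z :: complex
  proof (cases "u e = 0")
    case False
    have "2 * R + 1 \<le> real e"
      using that(1) by (simp only: nat_ceiling_le_eq)
    then have "norm (bump (u e) e z) \<le> 2 / u e"
      using that(2) False by (intro norm_bump_le[of _ _ R]) auto
    also have "\<dots> = 2 * (1 / u e)"
      by simp
    also have "\<dots> \<le> 2 * (1 / 4) ^ (e + 2)"
      using inverse_height[OF False] by (intro mult_left_mono) auto
    also have "\<dots> \<le> (1 / 4) ^ e"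
      by (simp add: power_add)
    finally show ?thesis .
  qed simp
  then show "\<forall>\<^sub>F e in sequentially. \<forall>z\<in>cball (0 :: complex) R. norm (bump (u e) e z) \<le> (1 / 4) ^ e"
    unfolding eventually_sequentially by blast
qed (simp add: summable_geometric)

text \<open>Locally uniform convergence of holomorphic functions carries over to their derivatives,
  so the series of derivatives needs no estimate of its own.\<close>

lemma series_derivative:
  obtains D where
    "\<And>z :: complex. (series has_field_derivative D z) (at z)"
    "\<And>z. (\<lambda>n. \<Sum>e<n. bump_deriv (u e) e z) \<longlonglongrightarrow> D z"
proof -
  have "\<exists>D. \<forall>z::complex\<in>UNIV. (series has_field_derivative D z) (at z) \<and>
      (\<lambda>n. \<Sum>e<n. bump_deriv (u e) e z) \<longlonglongrightarrow> D z"
  proof (rule has_complex_derivative_uniform_sequence[where f = "\<lambda>n z. \<Sum>e<n. bump (u e) e z"])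
    show "((\<lambda>z. \<Sum>e<n. bump (u e) e z) has_field_derivative (\<Sum>e<n. bump_deriv (u e) e z)) (at z)"
      for n and z :: complex
      by (intro DERIV_sum has_field_derivative_bump)
    fix z :: complex
    have "cball z 1 \<subseteq> cball 0 (norm z + 1)"
      by (rule cball_subset_cball_iff[THEN iffD2]) (simp add: dist_norm)
    then show "\<exists>d>0. cball z d \<subseteq> UNIV \<and>
        uniform_limit (cball z d) (\<lambda>n z. \<Sum>e<n. bump (u e) e z) series sequentially"
      using uniform_limit_on_subset[OF uniform_limit_series] by (intro exI[of _ 1]) auto
  qed auto
  then show ?thesis using that by blast
qed

lemma series_eq_Re: "(series :: real \<Rightarrow> real) = (\<lambda>x. Re (series (of_real x)))"
  by (simp add: series_of_real)

lemma series_Cinf: "(series :: real \<Rightarrow> real) \<in> Cinf_fun"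
proof -
  obtain D where "\<And>z :: complex. (series has_field_derivative D z) (at z)"
    using series_derivative by blast
  then have "(series :: complex \<Rightarrow> complex) holomorphic_on UNIV"
    by (auto simp: holomorphic_on_def field_differentiable_def)
  from Re_holomorphic_Cinf[OF this] show ?thesis
    by (simp flip: series_eq_Re)
qed

text \<open>The bump with centre \<open>d\<close> contributes exactly \<open>u d\<close>; the others
  contribute at most the sum of \<open>(1 / 4) ^ Suc e\<close>, which is below
  \<open>1 / 2\<close>.\<close>

lemma deriv_series_ge: "real (u d) - 1 / 2 \<le> deriv series (real d)"
proof -
  obtain D where D: "\<And>z :: complex. (series has_field_derivative D z) (at z)"
    and lim: "\<And>z. (\<lambda>n. \<Sum>e<n. bump_deriv (u e) e z) \<longlonglongrightarrow> D z"
    using series_derivative by blast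
  have "deriv series (real d) = Re (D (of_real (real d)))"
    by (subst series_eq_Re) (intro DERIV_imp_deriv Re_holomorphic_has_derivative D)
  moreover have "(\<lambda>n. \<Sum>e<n. bump_deriv (u e) e (real d)) \<longlonglongrightarrow> Re (D (of_real (real d)))"
    using tendsto_Re[OF lim[of "of_real (real d)"]] by (simp only: bump_deriv_of_real Re_sum Re_complex_of_real)
  moreover have "real (u d) - 1 / 2 \<le> (\<Sum>e<n. bump_deriv (u e) e (real d))" if n: "Suc d \<le> n" for n
  proof -
    let ?S = "{..<n} - {d}"
    have "\<bar>bump_deriv (u e) e (real d)\<bar> \<le> (1 / 4) ^ Suc e" if "e \<noteq> d" for e
    proof (cases "u e = 0")
      case False
      then show ?thesis
        using abs_bump_deriv_le[of "u e" d e] that inverse_height[OF False] by (simp add: power_add)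
    qed (simp add: bump_deriv_def)
    then have "\<bar>\<Sum>e\<in>?S. bump_deriv (u e) e (real d)\<bar> \<le> (\<Sum>e\<in>?S. (1 / 4) ^ Suc e)"
      by (intro order_trans[OF sum_abs] sum_mono) auto
    also have "\<dots> \<le> (\<Sum>e<n. (1 / 4) ^ Suc e)"
      by (intro sum_mono2) auto
    also have "\<dots> = (1 / 4) * (\<Sum>e<n. (1 / 4) ^ e)"
      by (simp add: sum_distrib_left)
    also have "(\<Sum>e<n. (1 / 4 :: real) ^ e) = (1 - (1 / 4) ^ n) / (3 / 4)"
      by (subst sum_gp_strict) simp
    also have "1 / 4 * ((1 - (1 / 4) ^ n) / (3 / 4)) \<le> (1 / 2 :: real)"
      using zero_le_power[of "1 / 4 :: real" n] by (simp add: field_simps)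
    finally have "\<bar>\<Sum>e\<in>?S. bump_deriv (u e) e (real d)\<bar> \<le> 1 / 2" .
    moreover have "(\<Sum>e<n. bump_deriv (u e) e (real d)) =
        real (u d) + (\<Sum>e\<in>?S. bump_deriv (u e) e (real d))"
      using n by (subst sum.remove[of _ d]) (auto simp: bump_deriv_center)
    ultimately show ?thesis by linarith
  qed
  ultimately show ?thesis
    by (auto intro!: LIMSEQ_le_const)
qed

end

section \<open>The diagonal function\<close>

definition height :: "nat \<Rightarrow> nat \<Rightarrow> nat" where
  "height e s = (e + s + 2) ^ (2 * (e + s + 2))"

lemma height_ge: "4 ^ (e + s + 2) \<le> height e s"
proof -
  have "(2 ^ 2) ^ (e + s + 2) \<le> (e + s + 2) ^ (2 * (e + s + 2))"
    unfolding power_mult[symmetric] by (intro power_mono) auto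
  then show ?thesis by (simp add: height_def)
qed

lemma height_mono: "e \<le> e' \<Longrightarrow> s \<le> s' \<Longrightarrow> height e s \<le> height e' s'"
  unfolding height_def by (rule order_trans[OF power_mono power_increasing]) auto

definition halt_height :: "nat \<Rightarrow> nat" where
  "halt_height e = (if \<exists>s. halts_at e s then height e (THE s. halts_at e s) else 0)"

lemma halt_height_eq: "halts_at e s \<Longrightarrow> halt_height e = height e s"
  unfolding halt_height_def using halts_at_unique by (auto intro!: arg_cong[where f = "height e"])

interpretation bump_series halt_height
proof
  fix e
  show "halt_height e = 0 \<or> 4 ^ (e + 2) \<le> halt_height e"
  proof (cases "\<exists>s. halts_at e s")
    case True
    then obtain s where s: "halts_at e s" ..
    have "(4::nat) ^ (e + 2) \<le> 4 ^ (e + s + 2)"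
      by (intro power_increasing) auto
    from order_trans[OF this height_ge] show ?thesis
      by (simp only: halt_height_eq[OF s] simp_thms)
  qed (simp add: halt_height_def)
qed

text \<open>A machine has at most one halting time, so at most one summand survives. The left-hand
  side avoids \<open>halt_height\<close> and uses only primitive recursive data.\<close>

lemma sum_halts_at:
  "(\<Sum>s<j. of_bool (halts_at e s) * bump (height e s) e x) =
     (if \<exists>s<j. halts_at e s then bump (halt_height e) e x else 0)"
proof (cases "\<exists>s<j. halts_at e s")
  case True
  then obtain s where s: "s < j" "halts_at e s" by blast
  have "halts_at e i \<longleftrightarrow> i = s" for i
    using s(2) halts_at_unique by blast
  then have "(\<Sum>i<j. of_bool (halts_at e i) * bump (height e i) e x) =
      (\<Sum>i<j. if i = s then bump (halt_height e) e x else 0)"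
    by (intro sum.cong) (auto simp: halt_height_eq[OF s(2)])
  then show ?thesis
    using True s(1) by simp
qed (auto intro: sum.neutral)

text \<open>A bump that the double sum misses has \<open>e \<ge> j\<close> or a halting time
  \<open>s \<ge> j\<close>; its height grows with both, so it is small in either case.\<close>

lemma series_tail:
  fixes x :: real
  shows "\<bar>series x - (\<Sum>e<j. \<Sum>s<j. of_bool (halts_at e s) * bump (height e s) e x)\<bar> \<le> 1 / 2 ^ (j + 2)"
proof -
  let ?T = "\<lambda>e. if e < j \<and> (\<exists>s<j. halts_at e s) then bump (halt_height e) e x else 0"
  let ?g = "\<lambda>e. bump (halt_height e) e x - ?T e"
  have T: "?T sums (\<Sum>e<j. \<Sum>s<j. of_bool (halts_at e s) * bump (height e s) e x)"
    unfolding sum_halts_at using sums_finite[of "{..<j}" ?T] by (simp add: if_distrib cong: if_cong)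
  have g: "\<bar>?g e\<bar> \<le> (1 / 2) ^ (j + 3) * (1 / 2) ^ e" for e
  proof (cases "?g e = 0")
    case False
    then obtain s where s: "halts_at e s"
      by (auto simp: halt_height_def split: if_splits)
    have js: "j \<le> e \<or> j \<le> s"
    proof (rule ccontr)
      assume "\<not> (j \<le> e \<or> j \<le> s)"
      then have "e < j" "\<exists>s<j. halts_at e s" using s by (auto simp: not_le)
      then show False using False by simp
    qed
    have "?T e = 0"
      using False by (auto split: if_splits)
    then have "\<bar>?g e\<bar> = \<bar>bump (height e s) e x\<bar>"
      by (simp only: halt_height_eq[OF s] diff_zero)
    also have "\<dots> \<le> 1 / height e s"
      by (rule abs_bump_le) (simp add: height_def)
    also have "\<dots> \<le> 1 / 4 ^ (e + s + 2)"
    proof -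
      have "(4::real) ^ (e + s + 2) \<le> height e s"
        using height_ge[of e s] by (metis of_nat_le_iff of_nat_numeral of_nat_power)
      then show ?thesis by (simp add: frac_le)
    qed
    also have "\<dots> = (1 / 2) ^ (2 * (e + s + 2))"
      unfolding power_mult by (simp add: power_one_over)
    \<comment> \<open>In both cases \<open>j + 3 + e \<le> 2 * (e + s + 2)\<close>; the spare
      \<open>e\<close> makes the bounds summable.\<close>
    also have "\<dots> \<le> (1 / 2) ^ (j + 3 + e)"
      using js by (intro power_decreasing) auto
    finally show ?thesis by (simp add: power_add)
  qed simp
  have geo: "(\<lambda>e. (1 / 2 :: real) ^ (j + 3) * (1 / 2) ^ e) sums ((1 / 2) ^ (j + 3) * 2)"
    using geometric_sums[of "1 / 2 :: real"] by (intro sums_mult) simp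
  have "summable (\<lambda>e. \<bar>?g e\<bar>)"
    by (rule summable_comparison_test'[OF sums_summable[OF geo]]) (use g in simp)
  have eq: "series x - (\<Sum>e<j. \<Sum>s<j. of_bool (halts_at e s) * bump (height e s) e x) = (\<Sum>e. ?g e)"
    unfolding series_def using suminf_diff[OF summable_bump sums_summable[OF T]] sums_unique[OF T] by simp
  have "\<bar>\<Sum>e. ?g e\<bar> \<le> (\<Sum>e. \<bar>?g e\<bar>)"
    by (rule summable_rabs) fact
  also have "\<dots> \<le> (\<Sum>e. (1 / 2) ^ (j + 3) * (1 / 2) ^ e)"
    using g \<open>summable (\<lambda>e. \<bar>?g e\<bar>)\<close> sums_summable[OF geo] by (rule suminf_le)
  also have "\<dots> = (1 / 2) ^ (j + 3) * 2"
    by (rule sums_unique[OF geo, symmetric])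
  also have "\<dots> = 1 / 2 ^ (j + 2)"
    by (simp add: power_add power_one_over field_simps)
  finally show ?thesis
    unfolding eq .
qed

section \<open>Computability of the series\<close>

text \<open>Bounds \<open>\<bar>x - e\<bar>\<close> for \<open>\<bar>x\<bar> \<le> 2 ^ j\<close> and
  \<open>e < j\<close>.\<close>

definition radius :: "nat \<Rightarrow> nat" where
  "radius j = 2 ^ j + j"

text \<open>
  On \<open>[- 2 ^ j, 2 ^ j]\<close> the Taylor polynomials with \<open>N\<close> terms of the at most \<open>j * j\<close> relevant bumps
  are off by at most \<open>V * X * 2 ^ (5 * V ^ 4 * X ^ 2) / 2 ^ N\<close> each, where \<open>V = height j j\<close> and
  \<open>X = radius j\<close>.  The number \<open>N = num_terms j\<close> brings their total down to \<open>1 / 2 ^ (j + 2)\<close>,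
  because \<open>c \<le> 2 ^ c\<close> for \<open>c = j * j * (V * X)\<close>.
\<close>

definition num_terms :: "nat \<Rightarrow> nat" where
  "num_terms j = 5 * (height j j ^ 4 * (radius j)\<^sup>2) + (j * j * (height j j * radius j) + (j + 2))"

definition approx :: "nat \<Rightarrow> real \<Rightarrow> real" where
  "approx j x = (\<Sum>e<j. \<Sum>s<j. of_bool (halts_at e s) * bump_Taylor (num_terms j) (height e s) e x)"

lemma approx_error:
  assumes "\<bar>x\<bar> \<le> 2 ^ j"
  shows "\<bar>series x - approx j x\<bar> \<le> 1 / 2 ^ (j + 1)"
proof -
  let ?V = "height j j" and ?X = "radius j"
  let ?c = "j * j * (?V * ?X)"
  let ?b = "real (?V * ?X) * 2 ^ (5 * (?V ^ 4 * ?X\<^sup>2)) / 2 ^ num_terms j"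
  have "\<bar>(\<Sum>e<j. \<Sum>s<j. of_bool (halts_at e s) * bump (height e s) e x) - approx j x\<bar> =
      \<bar>\<Sum>e<j. \<Sum>s<j. of_bool (halts_at e s) *
        (bump (height e s) e x - bump_Taylor (num_terms j) (height e s) e x)\<bar>"
    by (simp add: approx_def right_diff_distrib sum_subtractf)
  also have "\<dots> \<le> (\<Sum>e<j. \<Sum>s<j. ?b)"
  proof (intro order_trans[OF sum_abs] sum_mono)
    fix e s assume "e \<in> {..<j}" "s \<in> {..<j}"
    then have "\<bar>bump (height e s) e x - bump_Taylor (num_terms j) (height e s) e x\<bar> \<le> ?b"
      using assms by (intro bump_Taylor_error height_mono) (auto simp: radius_def)
    then show "\<bar>of_bool (halts_at e s) *
        (bump (height e s) e x - bump_Taylor (num_terms j) (height e s) e x)\<bar> \<le> ?b"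
      by auto
  qed
  also have "\<dots> = real ?c / 2 ^ (?c + (j + 2))"
    by (simp add: num_terms_def power_add)
  also have "\<dots> = (real ?c / 2 ^ ?c) * (1 / 2 ^ (j + 2))"
    by (simp add: power_add)
  also have "\<dots> \<le> 1 * (1 / 2 ^ (j + 2))"
    using of_nat_less_two_power[of ?c, where ?'a = real] by (intro mult_right_mono) auto
  finally have "\<bar>(\<Sum>e<j. \<Sum>s<j. of_bool (halts_at e s) * bump (height e s) e x) - approx j x\<bar> \<le>
      1 / 2 ^ (j + 2)"
    by simp
  moreover have "1 / 2 ^ (j + 2) + 1 / 2 ^ (j + 2) = 1 / (2 :: real) ^ (j + 1)"
    by (simp add: field_simps)
  ultimately show ?thesis
    using series_tail[of x j] by linarith
qed

text \<open>
  All coefficients of \<open>approx j\<close> get the common denominator \<open>fact (num_terms j)\<close>; expanding the powers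
  \<open>(x - e) ^ (2 * i + 1)\<close> yields the numerators.  The subtraction \<open>2 * i + 1 - d\<close> is truncated only
  where the binomial coefficient vanishes.
\<close>

definition numerator :: "nat \<Rightarrow> nat \<Rightarrow> int" where
  "numerator j d = (\<Sum>e<j. \<Sum>s<j. \<Sum>i<num_terms j. int (of_bool (halts_at e s)) *
     (int (height e s * (height e s ^ 4) ^ i * (fact (num_terms j) div fact i) *
        ((2 * i + 1) choose d) * e ^ (2 * i + 1 - d)) * (- 1) ^ (i + (2 * i + 1 - d))))"

definition approx_code :: "nat \<Rightarrow> nat" where
  "approx_code j = list_encode (map (\<lambda>d. prod_encode (int_encode (numerator j d),
     fact (num_terms j) - 1)) [0..<2 * num_terms j])"

lemma PR_height [PR_intros]: "PR f \<Longrightarrow> PR g \<Longrightarrow> PR (\<lambda>x. height (f x) (g x))"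
  unfolding height_def by (intro PR_intros)

lemma PR_radius [PR_intros]: "PR f \<Longrightarrow> PR (\<lambda>x. radius (f x))"
  unfolding radius_def by (intro PR_intros)

lemma PR_num_terms [PR_intros]: "PR f \<Longrightarrow> PR (\<lambda>x. num_terms (f x))"
  unfolding num_terms_def by (intro PR_intros)

lemma PR_int_numerator [PR_int_intros]:
  assumes "PR f" "PR g"
  shows "PR_int (\<lambda>x. numerator (f x) (g x))"
  unfolding numerator_def
  by (intro PR_int_intros PR_intros assms PR_comp[OF assms(1)] PR_comp[OF assms(2)])

lemma PR_approx_code: "PR approx_code"
  unfolding approx_code_def[abs_def] by (intro PR_intros PR_int_intros)

lemma poly_Poly: "poly (map_poly of_rat (Poly cs)) (x :: real) = (\<Sum>i<length cs. of_rat (cs ! i) * x ^ i)"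
proof (induction cs)
  case (Cons c cs)
  then show ?case
    by (simp add: map_poly_pCons sum.lessThan_Suc_shift sum_distrib_left mult_ac
        del: sum.lessThan_Suc)
qed simp

lemma bump_Taylor_expand:
  assumes "0 < N"
  shows "bump_Taylor N u e x = (\<Sum>d<2 * N. (\<Sum>i<N. real (u * (u ^ 4) ^ i * ((2 * i + 1) choose d) *
      e ^ (2 * i + 1 - d)) * (- 1) ^ (i + (2 * i + 1 - d)) / fact i) * x ^ d)"
proof -
  have binom: "(x - real e) ^ (2 * i + 1) =
      (\<Sum>d<2 * N. real ((2 * i + 1) choose d) * x ^ d * (- real e) ^ (2 * i + 1 - d))"
    if "i < N" for i
  proof -
    have "(x - real e) ^ (2 * i + 1) =
        (\<Sum>d\<le>2 * i + 1. real ((2 * i + 1) choose d) * x ^ d * (- real e) ^ (2 * i + 1 - d))"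
      using binomial_ring[of x "- real e" "2 * i + 1"] by simp
    \<comment> \<open>The added binomial coefficients vanish; a range that does not depend on
      \<open>i\<close> permits swapping the sums.\<close>
    also have "\<dots> = (\<Sum>d<2 * N. real ((2 * i + 1) choose d) * x ^ d * (- real e) ^ (2 * i + 1 - d))"
      using that by (intro sum.mono_neutral_left) (auto simp: binomial_eq_0)
    finally show ?thesis .
  qed
  have pow: "(x - real e) ^ (2 * i + 1) = (x - real e) * ((x - real e)\<^sup>2) ^ i" for i
    by (simp add: power_mult)
  have "bump_Taylor N u e x =
      (\<Sum>i<N. real (u * (u ^ 4) ^ i) * (- 1) ^ i / fact i * (x - real e) ^ (2 * i + 1))"
    unfolding bump_Taylor_def sum_distrib_left pow
    by (intro sum.cong refl) (simp add: power_minus[of "_ * _"] power_mult_distrib mult_ac)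
  also have "\<dots> = (\<Sum>i<N. \<Sum>d<2 * N. real (u * (u ^ 4) ^ i * ((2 * i + 1) choose d) *
      e ^ (2 * i + 1 - d)) * (- 1) ^ (i + (2 * i + 1 - d)) / fact i * x ^ d)"
  proof (rule sum.cong[OF refl])
    fix i assume "i \<in> {..<N}"
    then have i: "i < N" by simp
    show "real (u * (u ^ 4) ^ i) * (- 1) ^ i / fact i * (x - real e) ^ (2 * i + 1) =
        (\<Sum>d<2 * N. real (u * (u ^ 4) ^ i * ((2 * i + 1) choose d) *
          e ^ (2 * i + 1 - d)) * (- 1) ^ (i + (2 * i + 1 - d)) / fact i * x ^ d)"
      unfolding binom[OF i] sum_distrib_left
      by (intro sum.cong refl)
        (simp only: power_minus[of "real e"] power_add of_nat_mult of_nat_power, simp add: mult_ac)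
  qed
  also have "\<dots> = (\<Sum>d<2 * N. \<Sum>i<N. real (u * (u ^ 4) ^ i * ((2 * i + 1) choose d) *
      e ^ (2 * i + 1 - d)) * (- 1) ^ (i + (2 * i + 1 - d)) / fact i * x ^ d)"
    by (rule sum.swap)
  finally show ?thesis
    by (simp add: sum_distrib_right)
qed

lemma fact_div_fact_real:
  assumes "i \<le> N"
  shows "real (fact N div fact i) = fact N / fact i"
  using real_of_nat_div[OF fact_dvd[OF assms]] by simp

lemma poly_approx_code: "poly (map_poly of_rat (rat_poly_decode (approx_code j))) x = approx j x"
proof -
  let ?N = "num_terms j"
  have N: "0 < ?N" by (simp add: num_terms_def)
  \<comment> \<open>\<open>rat_decode\<close> adds 1 to the second component, hence the 1 subtracted
    from the denominator.\<close>
  have coeff: "rat_decode (prod_encode (int_encode (numerator j d), fact ?N - Suc 0)) =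
      of_int (numerator j d) / fact ?N" for d
    by (simp add: rat_decode_def)
  have of_rat_fact: "of_rat (fact n) = (fact n :: real)" for n
    by (metis of_nat_fact of_rat_of_nat_eq)
  have num: "real_of_int (numerator j d) / fact ?N = (\<Sum>e<j. \<Sum>s<j. of_bool (halts_at e s) *
      (\<Sum>i<?N. real (height e s * (height e s ^ 4) ^ i * ((2 * i + 1) choose d) *
        e ^ (2 * i + 1 - d)) * (- 1) ^ (i + (2 * i + 1 - d)) / fact i))" for d
    unfolding numerator_def of_int_sum sum_divide_distrib sum_distrib_left
    by (intro sum.cong refl) (simp add: fact_div_fact_real)
  have "poly (map_poly of_rat (rat_poly_decode (approx_code j))) x =
      (\<Sum>d<2 * ?N. real_of_int (numerator j d) / fact ?N * x ^ d)"
    by (simp add: rat_poly_decode_def approx_code_def poly_Poly coeff of_rat_divide of_rat_fact)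
  also have "\<dots> = (\<Sum>d<2 * ?N. \<Sum>e<j. \<Sum>s<j. of_bool (halts_at e s) *
      ((\<Sum>i<?N. real (height e s * (height e s ^ 4) ^ i * ((2 * i + 1) choose d) *
        e ^ (2 * i + 1 - d)) * (- 1) ^ (i + (2 * i + 1 - d)) / fact i) * x ^ d))"
    unfolding num sum_distrib_right by (simp only: mult.assoc sum_distrib_right)
  also have "\<dots> = (\<Sum>e<j. \<Sum>s<j. \<Sum>d<2 * ?N. of_bool (halts_at e s) *
      ((\<Sum>i<?N. real (height e s * (height e s ^ 4) ^ i * ((2 * i + 1) choose d) *
        e ^ (2 * i + 1 - d)) * (- 1) ^ (i + (2 * i + 1 - d)) / fact i) * x ^ d))"
    by (subst sum.swap) (intro sum.cong refl sum.swap)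
  also have "\<dots> = approx j x"
    unfolding approx_def bump_Taylor_expand[OF N] by (simp only: sum_distrib_left)
  finally show ?thesis .
qed

lemma series_C0_computable: "C0_computable (series :: real \<Rightarrow> real)"
proof -
  have "C0_name series (\<lambda>k l. rat_poly_decode (approx_code (k + l + 1)))"
    unfolding C0_name_def
  proof (intro allI)
    fix k l :: nat
    \<comment> \<open>This index covers the interval, as \<open>l \<le> ?j\<close>, and its error
      \<open>1 / 2 ^ (k + l + 2)\<close> is far enough below \<open>1 / 2 ^ k\<close> for the
      supremum to stay strictly below.\<close>
    let ?j = "k + l + 1"
    have "\<bar>series x - poly (map_poly of_rat (rat_poly_decode (approx_code ?j))) x\<bar> \<le> 1 / 2 ^ (?j + 1)"
      if "x \<in> {- (2 ^ l)..2 ^ l}" for x :: real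
    proof -
      have "(2 :: real) ^ l \<le> 2 ^ ?j" by (intro power_increasing) auto
      then show ?thesis
        unfolding poly_approx_code using that by (intro approx_error) auto
    qed
    then have "(SUP x\<in>{- (2 ^ l)..2 ^ l :: real}.
        \<bar>series x - poly (map_poly of_rat (rat_poly_decode (approx_code ?j))) x\<bar>) \<le> 1 / 2 ^ (?j + 1)"
      by (intro cSUP_least) auto
    also have "\<dots> < 1 / (2 :: real) ^ k"
      by (intro divide_strict_left_mono power_strict_increasing) auto
    finally show "(SUP x\<in>{- (2 ^ l)..2 ^ l :: real}.
        \<bar>series x - poly (map_poly of_rat (rat_poly_decode (approx_code ?j))) x\<bar>) < 1 / 2 ^ k" .
  qed
  moreover have "series \<in> C0_fun"
    using series_Cinf unfolding Cinf_fun_def C0_fun_def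
    by (auto intro!: differentiable_imp_continuous_on dest: spec[of _ "0::nat"])
  ultimately show ?thesis
    unfolding C0_computable_def using PR_tm_computable[OF PR_approx_code] by blast
qed

section \<open>Growth of decoded polynomials and non-computability of nearby derivatives\<close>

lemma length_list_decode_le: "length (list_decode n) \<le> n"
proof -
  have "length xs \<le> list_encode xs" for xs
    by (induction xs) (auto intro: order_trans[OF _ le_prod_encode_2])
  from this[of "list_decode n"] show ?thesis by simp
qed

lemma list_decode_elem_le: "a \<in> set (list_decode n) \<Longrightarrow> a \<le> n"
proof -
  have "a \<in> set xs \<Longrightarrow> a \<le> list_encode xs" for xs
    by (induction xs) (auto intro: le_SucI le_prod_encode_1 order_trans[OF _ le_prod_encode_2])
  from this[of "list_decode n"] show "a \<in> set (list_decode n) \<Longrightarrow> a \<le> n" by simp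
qed

lemma abs_rat_decode_le: "\<bar>rat_decode n\<bar> \<le> of_nat n"
proof -
  obtain a b where ab: "prod_decode n = (a, b)" by fastforce
  have "a \<le> n"
    using le_prod_encode_1[of a b] prod_decode_inverse[of n] ab by simp
  moreover have "\<bar>int_decode a\<bar> \<le> int a"
    by (auto simp: int_decode_def sum_decode_def elim: oddE)
  ultimately have "\<bar>int_decode a\<bar> \<le> int n" by linarith
  then have "(of_int \<bar>int_decode a\<bar> :: rat) \<le> of_int (int n)"
    by (simp only: of_int_le_iff)
  then have le_n: "\<bar>of_int (int_decode a) :: rat\<bar> \<le> of_nat n"
    by simp
  have "y / of_nat (Suc b) \<le> y" if "0 \<le> y" for y :: rat
    using that by (simp add: divide_le_eq distrib_left)
  then show ?thesis
    unfolding rat_decode_def ab prod.case abs_divide abs_of_nat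
    by (rule order_trans[OF _ le_n]) (rule abs_ge_zero)
qed

text \<open>The code \<open>n\<close> bounds the number of coefficients as well as the absolute
  value of each of them.\<close>

lemma abs_poly_decode_le:
  assumes "\<bar>x\<bar> \<le> c" "1 \<le> c"
  shows "\<bar>poly (map_poly of_rat (rat_poly_decode n)) x\<bar> \<le> real n * (real n * c ^ n)"
proof -
  let ?l = "list_decode n"
  have "\<bar>poly (map_poly of_rat (rat_poly_decode n)) x\<bar> \<le>
      (\<Sum>i<length ?l. \<bar>of_rat (rat_decode (?l ! i)) * x ^ i\<bar>)"
    unfolding rat_poly_decode_def poly_Poly by (rule order_trans[OF sum_abs]) simp
  also have "\<dots> \<le> (\<Sum>i<length ?l. real n * c ^ n)"
  proof (rule sum_mono)
    fix i assume "i \<in> {..<length ?l}"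
    then have i: "i < length ?l" by simp
    have "\<bar>rat_decode (?l ! i)\<bar> \<le> of_nat n"
      using abs_rat_decode_le[of "?l ! i"] list_decode_elem_le[OF nth_mem[OF i]]
      by (meson of_nat_le_iff order_trans)
    then have "\<bar>real_of_rat (rat_decode (?l ! i))\<bar> \<le> real n"
      by (metis abs_of_rat of_rat_less_eq of_rat_of_nat_eq)
    moreover have "\<bar>x ^ i\<bar> \<le> c ^ n"
    proof -
      have "\<bar>x ^ i\<bar> \<le> c ^ i" using assms by (simp add: power_abs power_mono)
      also have "\<dots> \<le> c ^ n"
        using assms i length_list_decode_le[of n] by (intro power_increasing) auto
      finally show ?thesis .
    qed
    ultimately show "\<bar>of_rat (rat_decode (?l ! i)) * x ^ i\<bar> \<le> real n * c ^ n"
      unfolding abs_mult by (intro mult_mono) auto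
  qed
  also have "\<dots> \<le> real n * (real n * c ^ n)"
    using length_list_decode_le[of n] assms by (simp add: mult_right_mono)
  finally show ?thesis .
qed

lemma power_self_add_3_le:
  fixes w :: nat
  assumes "2 \<le> w"
  shows "w ^ w + 3 \<le> w ^ (2 * w)"
proof -
  have "2 ^ 2 \<le> w ^ 2" using assms by (intro power_mono) auto
  also have "\<dots> \<le> w ^ w" using assms by (intro power_increasing) auto
  finally have W: "4 \<le> w ^ w" by simp
  then have "4 * w ^ w \<le> w ^ w * w ^ w" by (intro mult_le_mono1)
  with W show ?thesis
    unfolding mult_2 power_add by linarith
qed

text \<open>With \<open>w = e + s + 2\<close> the polynomial is at most
  \<open>w ^ (n + 2) \<le> w ^ w\<close>; squaring \<open>w ^ w\<close> leaves room for the
  3.\<close>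

lemma height_dominates_output:
  assumes "n \<le> e + s"
  shows "\<bar>poly (map_poly of_rat (rat_poly_decode n)) (real e)\<bar> + 3 \<le> height e s"
proof -
  let ?w = "e + s + 2"
  \<comment> \<open>The base is \<open>e + 1\<close>, as the bound requires a base of at least 1 and
    \<open>e\<close> may be 0.\<close>
  have "\<bar>poly (map_poly of_rat (rat_poly_decode n)) (real e)\<bar> \<le> real n * (real n * real (e + 1) ^ n)"
    by (rule abs_poly_decode_le) auto
  also have "\<dots> = real (n * (n * (e + 1) ^ n))"
    by simp
  also have "n * (n * (e + 1) ^ n) \<le> ?w * (?w * ?w ^ n)"
    using assms by (intro mult_le_mono power_mono) auto
  also have "\<dots> = ?w ^ (n + 2)"
    by simp
  also have "\<dots> \<le> ?w ^ ?w"
    using assms by (intro power_increasing) auto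
  finally have "\<bar>poly (map_poly of_rat (rat_poly_decode n)) (real e)\<bar> + 3 \<le> real (?w ^ ?w + 3)"
    by simp
  also have "?w ^ ?w + 3 \<le> height e s"
    unfolding height_def by (rule power_self_add_3_le) simp
  finally show ?thesis by simp
qed

lemma C1_fun_field_differentiable: "h \<in> C1_fun \<Longrightarrow> h field_differentiable at x"
  by (auto simp: C1_fun_def differentiable_on_def field_differentiable_def real_differentiable_def)

text \<open>The distance is truncated at 1; for \<open>r \<le> 1\<close> a distance below
  \<open>r\<close> still bounds the norm itself.\<close>

lemma C1_dist_deriv:
  assumes "C1_dist f g < r" "r \<le> 1" "f \<in> C1_fun" "g \<in> C1_fun"
  shows "\<bar>deriv f x - deriv g x\<bar> < r"
proof -
  have "ereal (max \<bar>f x - g x\<bar> \<bar>deriv (\<lambda>x. f x - g x) x\<bar>) \<le> C1_norm (\<lambda>x. f x - g x)"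
    unfolding C1_norm_def by (rule SUP_upper) simp
  also have "min (C1_norm (\<lambda>x. f x - g x)) 1 < ereal r"
    unfolding ereal_C1_dist[symmetric] using assms(1) by simp
  then have "C1_norm (\<lambda>x. f x - g x) < ereal r"
    using assms(2) by (auto simp: min_less_iff_disj one_ereal_def)
  finally have "ereal (max \<bar>f x - g x\<bar> \<bar>deriv (\<lambda>x. f x - g x) x\<bar>) < ereal r" .
  then have "\<bar>deriv (\<lambda>x. f x - g x) x\<bar> < r"
    by simp
  then show ?thesis
    using assms(3,4) by (simp add: C1_fun_field_differentiable deriv_diff)
qed

lemma deriv_near_series_noncomputable:
  assumes g: "g \<in> C1_fun" and near: "\<And>x. \<bar>deriv series x - deriv g x\<bar> < 1 / 2"
  shows "\<not> C0_computable (deriv g)"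
proof
  assume "C0_computable (deriv g)"
  then obtain P M where P: "C0_name (deriv g) P" and M: "wf_tm M"
    and out: "\<forall>k l. \<exists>n. tm_outputs M k l n \<and> rat_poly_decode n = P k l"
    unfolding C0_computable_def tm_computable_def by blast
  obtain e where e: "codes_tm e M" using codes_tm_exists by blast
  obtain n where n: "tm_outputs M 0 e n" "rat_poly_decode n = P 0 e" using out by blast
  obtain s where s: "halts_at e s" "n \<le> e + s" using halts_at_output[OF M e n(1)] by blast
  let ?p = "poly (map_poly of_rat (P 0 e)) :: real \<Rightarrow> real"
  let ?I = "{- (2 ^ e)..2 ^ e :: real}"
  \<comment> \<open>A real supremum bounds its members only if the set is bounded above; continuity
    on the compact interval provides this.\<close>
  have "continuous_on UNIV (\<lambda>x. \<bar>deriv g x - ?p x\<bar>)"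
    using g by (auto simp: C1_fun_def intro!: continuous_intros)
  then have "compact ((\<lambda>x. \<bar>deriv g x - ?p x\<bar>) ` ?I)"
    by (intro compact_continuous_image) (auto intro: continuous_on_subset)
  then have "bdd_above ((\<lambda>x. \<bar>deriv g x - ?p x\<bar>) ` ?I)"
    by (intro bounded_imp_bdd_above compact_imp_bounded)
  moreover have "real e \<in> ?I"
    using of_nat_less_two_power[of e, where ?'a = real] by (auto intro: order_trans[of _ 0])
  ultimately have "\<bar>deriv g (real e) - ?p (real e)\<bar> \<le> (SUP x\<in>?I. \<bar>deriv g x - ?p x\<bar>)"
    by (intro cSUP_upper)
  also have "\<dots> < 1 / 2 ^ 0"
    using P unfolding C0_name_def by blast
  finally have "\<bar>deriv g (real e) - ?p (real e)\<bar> < 1"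
    by simp
  moreover have "\<bar>?p (real e)\<bar> + 3 \<le> height e s"
    using height_dominates_output[OF s(2)] n(2) by simp
  moreover have "real (height e s) - 1 / 2 \<le> deriv series (real e)"
    using deriv_series_ge[of e] halt_height_eq[OF s(1)] by simp
  \<comment> \<open>The derivative of \<open>g\<close> at \<open>e\<close> exceeds
    \<open>height e s - 1\<close>, but as it is within 1 of the polynomial it is below
    \<open>height e s - 2\<close>.\<close>
  ultimately show False
    using near[of "real e"] by linarith
qed

theorem theorem1:
  shows "\<exists>f. f \<in> Cinf_fun \<and> C0_computable f \<and>
    robustly_noncomputable_at C1_topology C0_computable C0_computable deriv f"
proof (intro exI[of _ series] conjI series_Cinf series_C0_computable)
  interpret Metric_space C1_fun C1_dist by (rule Metric_space_C1)
  have C1: "series \<in> C1_fun"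
  proof -
    have "(deriv ^^ n) (series :: real \<Rightarrow> real) differentiable_on UNIV" for n
      using series_Cinf by (simp add: Cinf_fun_def)
    from this[of 0] this[of 1] show ?thesis
      unfolding C1_fun_def using differentiable_imp_continuous_on by auto
  qed
  \<comment> \<open>The ball of radius \<open>1 / 2\<close> is the required neighbourhood:
    derivatives in it differ from that of the series by less than \<open>1 / 2\<close>
    everywhere.\<close>
  have noncomp: "\<not> C0_computable (deriv g)" if "g \<in> mball series (1 / 2)" for g
    using that by (intro deriv_near_series_noncomputable C1_dist_deriv) auto
  show "robustly_noncomputable_at mtopology C0_computable C0_computable deriv series"
    unfolding robustly_noncomputable_at_def
  proof (intro conjI exI[of _ "mball series (1 / 2)"] ballI)
    show "\<not> C0_computable (deriv series)"
      using C1 by (intro noncomp) simp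
  qed (use C1 series_C0_computable noncomp in auto)
qed

end
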